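(* Consider the log marginal likelihood $$\mathcal{L}(\theta)=-\tfrac12 y^{T}\tilde K_\theta^{-1}y-\tfrac12\log\det\tilde K_\theta-\tfrac n2\log 2\pi,\qquad \tilde K_\theta=\sigma_f^2\,Z\,W(\theta)\,Z^{*}+\sigma_n^2 I_n ,$$ of the Gauss--Legendre features model. After an $O(ns^{2})$ preprocessing step of computing $Z^{*}Z$, and discounting the cost of computing the partial derivatives of $p$ with respect to the hyperparameters, the log marginal likelihood $\mathcal{L}(\theta)$ and the gradient $\nabla\mathcal{L}(\theta)$ can be computed in $O(ns+s^{3}+s|\theta|)$ arithmetic operations, where $|\theta|$ is the number of hyperparameters in $\theta$. Furthermore, the amount of memory storage required is $O(s^{2})$.
   Context: Data: points $x_1,\dots,x_n\in\mathcal{X}\subseteq\mathbb{R}^d$ and responses $y\in\mathbb{R}^n$. Hyperparameters are $\theta=[\theta_0,\sigma_f^2,\sigma_n^2]$ with $\sigma_f^2,\sigma_n^2>0$ and $\theta_0$ possibly a vector; the gradient is with respect to all entries of $\theta$. $\varphi:\mathcal{X}\times\mathbb{R}^d\to\mathbb{C}$ is a fixed function with $\varphi(x,\eta)=\varphi(x,-\eta)^*$ and, for each $\theta_0$, $p(\cdot;\theta_0)$ is an even probability density on $\mathbb{R}^d$, depending differentiably on $\theta_0$. The nodes $\eta_1,\dots,\eta_s\in\mathbb{R}^d$ and weights $w_1,\dots,w_s>0$ are fixed (independent of $\theta$): they are the nodes and weights of a tensorized Gauss--Legendre quadrature rescaled to a box $\prod_{k=1}^d[-U_k,U_k]$. The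 feature matrix $Z\in\mathbb{C}^{n\times s}$, $Z_{lj}=\varphi(x_l,\eta_j)$, does not depend on $\theta$, and $W(\theta)=\mathrm{diag}(h_1(\theta_0),\dots,h_s(\theta_0))$ with $h_j(\theta_0)=w_j\,p(\eta_j;\theta_0)$, assumed positive. "Discounting the cost of computing the partial derivatives of $p$" means that the values $\partial p(\eta_j;\theta_0)/\partial\theta_i$ are taken as given. The memory count is based on the possibility of streaming over the training points without storing the whole of $Z$. *)

theory Defs
  imports
    "HOL-Analysis.Analysis"
    "Jordan_Normal_Form.Schur_Decomposition"
    "Jordan_Normal_Form.Gauss_Jordan_Elimination"
begin

section \<open>Differentiability on coordinate spaces of varying dimension\<close>

text \<open>
  Dimensions are natural numbers that are quantified inside the statement, so a point of
  $m$-dimensional space is an element of \<^term>\<open>{..<m} \<rightarrow>\<^sub>E (UNIV :: real set)\<close>, the space of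
  the product measure \<^term>\<open>Pi\<^sub>M {..<m} (\<lambda>_. lborel)\<close>.
\<close>

abbreviation Rn :: "nat \<Rightarrow> (nat \<Rightarrow> real) set" where
  "Rn m \<equiv> {..<m} \<rightarrow>\<^sub>E UNIV"

text \<open>Frechet differentiability at \<open>x\<close> with gradient vector \<open>(g 0, ..., g (m - 1))\<close>.\<close>

definition has_gradient ::
    "nat \<Rightarrow> ((nat \<Rightarrow> real) \<Rightarrow> real) \<Rightarrow> (nat \<Rightarrow> real) \<Rightarrow> (nat \<Rightarrow> real) \<Rightarrow> bool" where
  "has_gradient m f g x \<longleftrightarrow>
     (\<forall>\<epsilon>>0. \<exists>\<delta>>0. \<forall>v\<in>Rn m. L2_set (\<lambda>i. v i - x i) {..<m} < \<delta> \<longrightarrow>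
        \<bar>f v - f x - (\<Sum>i<m. g i * (v i - x i))\<bar> \<le> \<epsilon> * L2_set (\<lambda>i. v i - x i) {..<m})"

definition partial_deriv :: "((nat \<Rightarrow> real) \<Rightarrow> real) \<Rightarrow> nat \<Rightarrow> (nat \<Rightarrow> real) \<Rightarrow> real" where
  "partial_deriv f i x = deriv (\<lambda>t. f (x(i := t))) (x i)"


section \<open>Gauss--Legendre quadrature\<close>

fun legendre :: "nat \<Rightarrow> real poly" where
  "legendre 0 = 1"
| "legendre (Suc 0) = [:0, 1:]"
| "legendre (Suc (Suc k)) =
     Polynomial.smult (1 / (real k + 2))
       (Polynomial.smult (2 * real k + 3) ([:0, 1:] * legendre (Suc k)) -
        Polynomial.smult (real k + 1) (legendre k))"

text \<open>
  The \<open>r\<close>-point rule on $[-1,1]$. As \<^term>\<open>legendre r\<close> has degree \<open>r\<close>, the \<open>r\<close> distinct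
  nodes are all of its roots.
\<close>

definition gauss_legendre :: "nat \<Rightarrow> (nat \<Rightarrow> real) \<Rightarrow> (nat \<Rightarrow> real) \<Rightarrow> bool" where
  "gauss_legendre r \<xi> \<omega> \<longleftrightarrow>
     strict_mono_on {..<r} \<xi> \<and>
     (\<forall>i<r. poly (legendre r) (\<xi> i) = 0 \<and>
            \<omega> i = 2 / ((1 - (\<xi> i)\<^sup>2) * (poly (pderiv (legendre r)) (\<xi> i))\<^sup>2))"

text \<open>
  The tensor product rule on the box with half-widths \<open>U\<close>, with \<open>r k\<close> points in direction \<open>k\<close>;
  \<open>e\<close> enumerates the multi-indices.
\<close>

definition tensor_gauss_legendre ::
    "nat \<Rightarrow> (nat \<Rightarrow> real) \<Rightarrow> nat \<Rightarrow> (nat \<Rightarrow> nat \<Rightarrow> real) \<Rightarrow> (nat \<Rightarrow> real) \<Rightarrow> bool" where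
  "tensor_gauss_legendre d U s \<eta> w \<longleftrightarrow>
     (\<exists>r \<xi> \<omega> e.
        (\<forall>k<d. 1 \<le> r k \<and> gauss_legendre (r k) (\<xi> k) (\<omega> k)) \<and>
        bij_betw e {..<s} (PiE {..<d} (\<lambda>k. {..<r k})) \<and>
        (\<forall>j<s. \<eta> j = (\<lambda>k\<in>{..<d}. U k * \<xi> k (e j k)) \<and>
               w j = (\<Prod>k<d. U k * \<omega> k (e j k))))"


section \<open>The Gauss--Legendre features model\<close>

text \<open>
  Everything except the hyperparameters. \<open>pdim\<close> is the number of entries of $\theta_0$ and
  \<open>pdom\<close> its domain; \<open>dens t\<close> is the density $p(\cdot;t)$.
\<close>

record gl_model =
  xdim :: nat
  xdom :: "(nat \<Rightarrow> real) set"
  npts :: nat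
  xpt :: "nat \<Rightarrow> nat \<Rightarrow> real"
  resp :: "nat \<Rightarrow> real"
  feat :: "(nat \<Rightarrow> real) \<Rightarrow> (nat \<Rightarrow> real) \<Rightarrow> complex"
  pdim :: nat
  pdom :: "(nat \<Rightarrow> real) set"
  dens :: "(nat \<Rightarrow> real) \<Rightarrow> (nat \<Rightarrow> real) \<Rightarrow> real"
  halfwidth :: "nat \<Rightarrow> real"
  nnodes :: nat
  node :: "nat \<Rightarrow> nat \<Rightarrow> real"
  wgt :: "nat \<Rightarrow> real"

definition neg_vec :: "nat \<Rightarrow> (nat \<Rightarrow> real) \<Rightarrow> nat \<Rightarrow> real" where
  "neg_vec d v = (\<lambda>k\<in>{..<d}. - v k)"

definition even_density :: "nat \<Rightarrow> ((nat \<Rightarrow> real) \<Rightarrow> real) \<Rightarrow> bool" where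
  "even_density d f \<longleftrightarrow>
     f \<in> borel_measurable (Pi\<^sub>M {..<d} (\<lambda>_. lborel)) \<and>
     (\<forall>v\<in>Rn d. 0 \<le> f v \<and> f (neg_vec d v) = f v) \<and>
     (\<integral>\<^sup>+ v. ennreal (f v) \<partial>(Pi\<^sub>M {..<d} (\<lambda>_. lborel))) = 1"

definition gl_features :: "gl_model \<Rightarrow> bool" where
  "gl_features M \<longleftrightarrow>
     1 \<le> xdim M \<and> 1 \<le> npts M \<and> 1 \<le> pdim M \<and>
     xdom M \<subseteq> Rn (xdim M) \<and> (\<forall>l<npts M. xpt M l \<in> xdom M) \<and>
     (\<forall>x\<in>xdom M. \<forall>v\<in>Rn (xdim M). feat M x v = cnj (feat M x (neg_vec (xdim M) v))) \<and>
     openin (product_topology (\<lambda>_. euclideanreal) {..<pdim M}) (pdom M) \<and>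
     (\<forall>t\<in>pdom M. even_density (xdim M) (dens M t)) \<and>
     (\<forall>v\<in>Rn (xdim M). \<forall>t\<in>pdom M. \<exists>g. has_gradient (pdim M) (\<lambda>t'. dens M t' v) g t) \<and>
     (\<forall>k<xdim M. 0 < halfwidth M k) \<and>
     tensor_gauss_legendre (xdim M) (halfwidth M) (nnodes M) (node M) (wgt M) \<and>
     (\<forall>j<nnodes M. 0 < wgt M j) \<and>
     (\<forall>t\<in>pdom M. \<forall>j<nnodes M. 0 < wgt M j * dens M t (node M j))"

text \<open>
  A hyperparameter vector lists the entries of $\theta_0$, then $\sigma_f^2$, then $\sigma_n^2$;
  hence $|\theta|$ is \<open>pdim M + 2\<close>.
\<close>

definition theta0 :: "gl_model \<Rightarrow> (nat \<Rightarrow> real) \<Rightarrow> nat \<Rightarrow> real" where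
  "theta0 M \<theta> = restrict \<theta> {..<pdim M}"

definition sigma_f2 :: "gl_model \<Rightarrow> (nat \<Rightarrow> real) \<Rightarrow> real" where
  "sigma_f2 M \<theta> = \<theta> (pdim M)"

definition sigma_n2 :: "gl_model \<Rightarrow> (nat \<Rightarrow> real) \<Rightarrow> real" where
  "sigma_n2 M \<theta> = \<theta> (pdim M + 1)"

definition nhyper :: "gl_model \<Rightarrow> nat" where
  "nhyper M = pdim M + 2"

definition hyperparams :: "gl_model \<Rightarrow> (nat \<Rightarrow> real) set" where
  "hyperparams M =
     {\<theta> \<in> Rn (nhyper M). theta0 M \<theta> \<in> pdom M \<and> 0 < sigma_f2 M \<theta> \<and> 0 < sigma_n2 M \<theta>}"

definition feature_mat :: "gl_model \<Rightarrow> complex mat" where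
  "feature_mat M = Matrix.mat (npts M) (nnodes M) (\<lambda>(l, j). feat M (xpt M l) (node M j))"

definition weight_mat :: "gl_model \<Rightarrow> (nat \<Rightarrow> real) \<Rightarrow> complex mat" where
  "weight_mat M \<theta> =
     mat_diag (nnodes M) (\<lambda>j. complex_of_real (wgt M j * dens M (theta0 M \<theta>) (node M j)))"

definition kernel_mat :: "gl_model \<Rightarrow> (nat \<Rightarrow> real) \<Rightarrow> complex mat" where
  "kernel_mat M \<theta> =
     complex_of_real (sigma_f2 M \<theta>) \<cdot>\<^sub>m
       (feature_mat M * weight_mat M \<theta> * mat_adjoint (feature_mat M)) +
     complex_of_real (sigma_n2 M \<theta>) \<cdot>\<^sub>m 1\<^sub>m (npts M)"

text \<open>
  The kernel matrix is Hermitian positive definite for hyperparameters in the domain, so the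
  quadratic form and the determinant are real and \<^const>\<open>Re\<close> is only a type conversion.
\<close>

definition log_marginal :: "gl_model \<Rightarrow> (nat \<Rightarrow> real) \<Rightarrow> real" where
  "log_marginal M \<theta> =
     (let K = kernel_mat M \<theta>; yv = Matrix.vec (npts M) (\<lambda>l. complex_of_real (resp M l)) in
       - 1 / 2 * Re (scalar_prod yv (the (mat_inverse K) *\<^sub>v yv))
       - 1 / 2 * ln (Re (Determinant.det K))
       - real (npts M) / 2 * ln (2 * pi))"

definition gram_mat :: "gl_model \<Rightarrow> complex mat" where
  "gram_mat M = mat_adjoint (feature_mat M) * feature_mat M"


section \<open>A random access machine over the complex numbers\<close>

text \<open>
  Programs are finite syntactic objects, the same for all sizes and all data. The working store
  consists of cells, each holding one complex number and addressed by an array name and two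
  indices. Indices are built from loop counters and problem sizes; numbers in the store can
  influence neither indices nor control flow. The training points form a read-only input that is
  streamed: only the current point can be accessed, and \<open>Next\<close> moves to the following one.
  Results are written to a write-only output stream.
\<close>

datatype iexp =
    INum nat
  | IVar nat
  | SizeN
  | SizeS
  | SizeP
  | IAdd iexp iexp

text \<open>
  \<open>Resp\<close> and \<open>Feat j\<close> read $y_l$ and $\varphi(x_l,\eta_j)$ for the current training point $x_l$.
  \<open>Dens j\<close> is $p(\eta_j;\theta_0)$, and \<open>DDens i j\<close> is its partial derivative with respect to
  entry \<open>i\<close> of $\theta_0$. \<open>Log\<close> is the real logarithm.
\<close>

datatype cexp =
    Num int
  | PiConst
  | Cell nat iexp iexp
  | Resp
  | Feat iexp
  | Wgt iexp
  | Dens iexp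
  | DDens iexp iexp
  | SigF2
  | SigN2
  | Add cexp cexp
  | Sub cexp cexp
  | Mul cexp cexp
  | Div cexp cexp
  | Cnj cexp
  | Log cexp

datatype com =
    Assign nat iexp iexp cexp
  | Emit cexp
  | Next
  | Seq com com
  | For nat iexp iexp com

record machine =
  store :: "nat \<Rightarrow> nat \<Rightarrow> nat \<Rightarrow> complex"
  touched :: "(nat \<times> nat \<times> nat) set"
  pos :: nat
  out :: "complex list"
  steps :: nat

primrec ieval :: "gl_model \<Rightarrow> (nat \<Rightarrow> nat) \<Rightarrow> iexp \<Rightarrow> nat" where
  "ieval M \<rho> (INum k) = k"
| "ieval M \<rho> (IVar v) = \<rho> v"
| "ieval M \<rho> SizeN = npts M"
| "ieval M \<rho> SizeS = nnodes M"
| "ieval M \<rho> SizeP = pdim M"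
| "ieval M \<rho> (IAdd a b) = ieval M \<rho> a + ieval M \<rho> b"

primrec ceval ::
    "gl_model \<Rightarrow> (nat \<Rightarrow> real) \<Rightarrow> (nat \<Rightarrow> nat) \<Rightarrow> machine \<Rightarrow> cexp \<Rightarrow> complex" where
  "ceval M \<theta> \<rho> \<sigma> (Num k) = of_int k"
| "ceval M \<theta> \<rho> \<sigma> PiConst = of_real pi"
| "ceval M \<theta> \<rho> \<sigma> (Cell a i j) = store \<sigma> a (ieval M \<rho> i) (ieval M \<rho> j)"
| "ceval M \<theta> \<rho> \<sigma> Resp = of_real (resp M (pos \<sigma>))"
| "ceval M \<theta> \<rho> \<sigma> (Feat j) = feat M (xpt M (pos \<sigma>)) (node M (ieval M \<rho> j))"
| "ceval M \<theta> \<rho> \<sigma> (Wgt j) = of_real (wgt M (ieval M \<rho> j))"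
| "ceval M \<theta> \<rho> \<sigma> (Dens j) = of_real (dens M (theta0 M \<theta>) (node M (ieval M \<rho> j)))"
| "ceval M \<theta> \<rho> \<sigma> (DDens i j) =
     of_real (partial_deriv (\<lambda>t. dens M t (node M (ieval M \<rho> j))) (ieval M \<rho> i) (theta0 M \<theta>))"
| "ceval M \<theta> \<rho> \<sigma> SigF2 = of_real (sigma_f2 M \<theta>)"
| "ceval M \<theta> \<rho> \<sigma> SigN2 = of_real (sigma_n2 M \<theta>)"
| "ceval M \<theta> \<rho> \<sigma> (Add a b) = ceval M \<theta> \<rho> \<sigma> a + ceval M \<theta> \<rho> \<sigma> b"
| "ceval M \<theta> \<rho> \<sigma> (Sub a b) = ceval M \<theta> \<rho> \<sigma> a - ceval M \<theta> \<rho> \<sigma> b"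
| "ceval M \<theta> \<rho> \<sigma> (Mul a b) = ceval M \<theta> \<rho> \<sigma> a * ceval M \<theta> \<rho> \<sigma> b"
| "ceval M \<theta> \<rho> \<sigma> (Div a b) = ceval M \<theta> \<rho> \<sigma> a / ceval M \<theta> \<rho> \<sigma> b"
| "ceval M \<theta> \<rho> \<sigma> (Cnj a) = cnj (ceval M \<theta> \<rho> \<sigma> a)"
| "ceval M \<theta> \<rho> \<sigma> (Log a) = of_real (ln (Re (ceval M \<theta> \<rho> \<sigma> a)))"

text \<open>Every operation and every read costs one step.\<close>

primrec ccost :: "cexp \<Rightarrow> nat" where
  "ccost (Num k) = 1"
| "ccost PiConst = 1"
| "ccost (Cell a i j) = 1"
| "ccost Resp = 1"
| "ccost (Feat j) = 1"
| "ccost (Wgt j) = 1"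
| "ccost (Dens j) = 1"
| "ccost (DDens i j) = 1"
| "ccost SigF2 = 1"
| "ccost SigN2 = 1"
| "ccost (Add a b) = 1 + ccost a + ccost b"
| "ccost (Sub a b) = 1 + ccost a + ccost b"
| "ccost (Mul a b) = 1 + ccost a + ccost b"
| "ccost (Div a b) = 1 + ccost a + ccost b"
| "ccost (Cnj a) = 1 + ccost a"
| "ccost (Log a) = 1 + ccost a"

primrec creads :: "gl_model \<Rightarrow> (nat \<Rightarrow> nat) \<Rightarrow> cexp \<Rightarrow> (nat \<times> nat \<times> nat) set" where
  "creads M \<rho> (Num k) = {}"
| "creads M \<rho> PiConst = {}"
| "creads M \<rho> (Cell a i j) = {(a, ieval M \<rho> i, ieval M \<rho> j)}"
| "creads M \<rho> Resp = {}"
| "creads M \<rho> (Feat j) = {}"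
| "creads M \<rho> (Wgt j) = {}"
| "creads M \<rho> (Dens j) = {}"
| "creads M \<rho> (DDens i j) = {}"
| "creads M \<rho> SigF2 = {}"
| "creads M \<rho> SigN2 = {}"
| "creads M \<rho> (Add a b) = creads M \<rho> a \<union> creads M \<rho> b"
| "creads M \<rho> (Sub a b) = creads M \<rho> a \<union> creads M \<rho> b"
| "creads M \<rho> (Mul a b) = creads M \<rho> a \<union> creads M \<rho> b"
| "creads M \<rho> (Div a b) = creads M \<rho> a \<union> creads M \<rho> b"
| "creads M \<rho> (Cnj a) = creads M \<rho> a"
| "creads M \<rho> (Log a) = creads M \<rho> a"

text \<open>
  \<open>For v a b c\<close> runs \<open>c\<close> with counter \<open>v\<close> ranging over \<open>a, ..., b - 1\<close>; counters are lexically
  scoped, so a program uses boundedly many of them. Loop control is charged as well.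
\<close>

primrec exec ::
    "gl_model \<Rightarrow> (nat \<Rightarrow> real) \<Rightarrow> com \<Rightarrow> (nat \<Rightarrow> nat) \<Rightarrow> machine \<Rightarrow> machine" where
  "exec M \<theta> (Assign a i j e) \<rho> \<sigma> =
     (let i' = ieval M \<rho> i; j' = ieval M \<rho> j in
       \<sigma>\<lparr>store := (store \<sigma>)(a := (store \<sigma> a)(i' := (store \<sigma> a i')(j' := ceval M \<theta> \<rho> \<sigma> e))),
         touched := touched \<sigma> \<union> creads M \<rho> e \<union> {(a, i', j')},
         steps := steps \<sigma> + ccost e + 1\<rparr>)"
| "exec M \<theta> (Emit e) \<rho> \<sigma> =
     \<sigma>\<lparr>out := out \<sigma> @ [ceval M \<theta> \<rho> \<sigma> e],
       touched := touched \<sigma> \<union> creads M \<rho> e,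
       steps := steps \<sigma> + ccost e + 1\<rparr>"
| "exec M \<theta> Next \<rho> \<sigma> = \<sigma>\<lparr>pos := pos \<sigma> + 1, steps := steps \<sigma> + 1\<rparr>"
| "exec M \<theta> (Seq c c') \<rho> \<sigma> = exec M \<theta> c' \<rho> (exec M \<theta> c \<rho> \<sigma>)"
| "exec M \<theta> (For v a b c) \<rho> \<sigma> =
     fold (\<lambda>k \<tau>. exec M \<theta> c (\<rho>(v := k)) (\<tau>\<lparr>steps := steps \<tau> + 1\<rparr>))
       [ieval M \<rho> a ..< ieval M \<rho> b] (\<sigma>\<lparr>steps := steps \<sigma> + 1\<rparr>)"

text \<open>
  A run starts at the first training point. The cells in \<open>A\<close> are occupied from the start and
  count as used memory; the remaining cells have arbitrary contents.
\<close>

definition run ::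
    "gl_model \<Rightarrow> (nat \<Rightarrow> real) \<Rightarrow> com \<Rightarrow> (nat \<times> nat \<times> nat) set \<Rightarrow>
     (nat \<Rightarrow> nat \<Rightarrow> nat \<Rightarrow> complex) \<Rightarrow> machine" where
  "run M \<theta> c A m =
     exec M \<theta> c (\<lambda>_. 0) \<lparr>store = m, touched = A, pos = 0, out = [], steps = 0\<rparr>"

definition gram_cells :: "gl_model \<Rightarrow> (nat \<times> nat \<times> nat) set" where
  "gram_cells M = {0} \<times> {..<nnodes M} \<times> {..<nnodes M}"

definition holds_gram :: "gl_model \<Rightarrow> (nat \<Rightarrow> nat \<Rightarrow> nat \<Rightarrow> complex) \<Rightarrow> bool" where
  "holds_gram M m \<longleftrightarrow> (\<forall>j<nnodes M. \<forall>k<nnodes M. m 0 j k = gram_mat M $$ (j, k))"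

definition memory_at_most :: "machine \<Rightarrow> nat \<Rightarrow> bool" where
  "memory_at_most \<sigma> b \<longleftrightarrow> finite (touched \<sigma>) \<and> card (touched \<sigma>) \<le> b"

end

theory Submission
  imports Defs
begin

text \<open>
  Write $K = \tau I + \sum_{l<s} a_l z_l z_l^*$ with $\tau = \sigma_n^2$, $a_l = \sigma_f^2 h_l(\theta_0)$ and
  $z_l$ the columns of $Z$, and put $z_s = y$. The algorithm never forms $K$: it keeps the
  $(s+1) \times (s+1)$ matrix $Q_{ij} = z_i^* K^{-1} z_j$, starting from the Gram matrix divided by
  $\tau$ and adding the rank one terms one by one. A Sherman--Morrison step
  $Q_{ij} - a_k Q_{ik} Q_{kj} / (1 + a_k Q_{kk})$ costs $O(s^2)$, and by the matrix determinant lemma its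
  denominator is the factor by which $\det K$ grows; the denominators are positive because $K$ stays
  positive definite. At the end $y^T K^{-1} y = Q_{ss}$. Differentiating $K^{-1}$ and $\log\det K$ and using
  $\tau K^{-1} = I - \sum_l a_l K^{-1} z_l z_l^*$ gives
  $2\, d\mathcal{L} = \sum_l H_l\, da_l + (Q_{ss} - n - \sum_l a_l H_l)\, d\tau / \tau$ with
  $H_l = Q_{sl} Q_{ls} - Q_{ll}$, which is $O(s)$ operations per hyperparameter.
\<close>

section \<open>Rank one updates\<close>

text \<open>No stored number may steer control flow and no square root is available, which rules out
  pivoting and Cholesky factors. The rank one sweep needs neither: its denominators are 1 + a_k Q_kk
  with a_k > 0 and Q_kk real and nonnegative, hence at least 1.

  Differentiating the s sweeps entry by entry would cost O(s^3) per hyperparameter, so the gradient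
  is read off the final Q instead. The obstacle is the noise variance: its derivative involves tr
  K^{-1} and y^T K^{-2} y, neither of which is an entry of Q. Multiplied by tau, they become n -
  sum_l a_l Q_ll and Q_ss - sum_l a_l Q_sl Q_ls, which is what the identity for tau K^{-1} is for.
  The closed formulas are proved without matrix calculus, by induction on the number of updates: at
  every stage they agree with what the quotient rule gives for the recursion.

  Dimensions are natural numbers bound in the statement, so points are functions and
  \<open>has_gradient\<close> is spelled out with epsilon and delta; slopes bring the usual
  differentiation rules back.\<close>

definition cdot :: "nat \<Rightarrow> (nat \<Rightarrow> complex) \<Rightarrow> (nat \<Rightarrow> complex) \<Rightarrow> complex" where
  "cdot n x y = (\<Sum>l<n. cnj (x l) * y l)"

lemma cdot_diff_right: "cdot n x (\<lambda>l. y l - y' l) = cdot n x y - cdot n x y'"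
  by (simp add: cdot_def algebra_simps sum_subtractf)

lemma cdot_scale_right: "cdot n x (\<lambda>l. c * y l) = c * cdot n x y"
  by (simp add: cdot_def sum_distrib_left mult_ac)

lemma cdot_add_right: "cdot n x (\<lambda>l. y l + y' l) = cdot n x y + cdot n x y'"
  by (simp add: cdot_def algebra_simps sum.distrib)

lemma cdot_sum_right: "cdot n x (\<lambda>l. \<Sum>j\<in>A. f j l) = (\<Sum>j\<in>A. cdot n x (f j))"
  unfolding cdot_def sum_distrib_left by (rule sum.swap)

lemma cnj_cdot: "cnj (cdot n x y) = cdot n y x"
  by (simp add: cdot_def mult_ac)

lemma cdot_self: "cdot n x x = of_real (\<Sum>l<n. (cmod (x l))\<^sup>2)"
  unfolding cdot_def of_real_sum
  by (intro sum.cong refl) (metis complex_norm_square mult.commute of_real_power)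

lemma one_plus_neq_0: "0 \<le> c \<Longrightarrow> 0 \<le> r \<Longrightarrow> 1 + complex_of_real c * of_real r \<noteq> 0"
proof -
  assume "0 \<le> c" "0 \<le> r"
  then have "1 + c * r > 0" by (simp add: add_pos_nonneg)
  moreover have "1 + complex_of_real c * of_real r = of_real (1 + c * r)" by simp
  ultimately show ?thesis by (metis of_real_eq_0_iff less_irrefl)
qed

text \<open>Sherman--Morrison, applied to all entries $z_i^* K^{-1} z_j$ at once.\<close>

fun sweep :: "(nat \<Rightarrow> nat \<Rightarrow> complex) \<Rightarrow> (nat \<Rightarrow> complex) \<Rightarrow> nat \<Rightarrow> nat \<Rightarrow> nat \<Rightarrow> complex" where
  "sweep q a 0 i j = q i j"
| "sweep q a (Suc k) i j = sweep q a k i j -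
     a k * sweep q a k i k * sweep q a k k j / (1 + a k * sweep q a k k k)"

text \<open>Only the vectors of \<open>z\<close> below \<open>s\<close> act as updates; the vector
  at index \<open>s\<close> will be the response vector, to which the same inverse is
  applied.\<close>

locale rank_one_updates =
  fixes n s :: nat and \<tau> :: real and a :: "nat \<Rightarrow> real" and z :: "nat \<Rightarrow> nat \<Rightarrow> complex"
  assumes tau_pos: "0 < \<tau>" and a_pos: "k < s \<Longrightarrow> 0 < a k"
begin

text \<open>The matrix tau I + sum of a_j z_j z_j^* over j < k, as an operator on functions. It acts
  on all indices, also those from \<open>n\<close> on, so that inversion can be stated as an
  equation between functions.\<close>

definition upd :: "nat \<Rightarrow> (nat \<Rightarrow> complex) \<Rightarrow> nat \<Rightarrow> complex" where
  "upd k x = (\<lambda>l. complex_of_real \<tau> * x l + (\<Sum>j<k. a j * cdot n (z j) x * z j l))"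

text \<open>The inverse of \<open>upd k\<close> as the Sherman--Morrison formula builds it up;
  \<open>upd_sol\<close> confirms this.\<close>

primrec sol :: "nat \<Rightarrow> (nat \<Rightarrow> complex) \<Rightarrow> nat \<Rightarrow> complex" where
  "sol 0 x = (\<lambda>l. 1 / complex_of_real \<tau> * x l)"
| "sol (Suc k) x = (\<lambda>l. sol k x l -
     a k * cdot n (z k) (sol k x) / (1 + a k * cdot n (z k) (sol k (z k))) * sol k (z k) l)"

lemma upd_Suc: "upd (Suc k) x l = upd k x l + a k * cdot n (z k) x * z k l"
  by (simp add: upd_def)

lemma upd_diff_scale: "upd k (\<lambda>l. x l - c * y l) l = upd k x l - c * upd k y l"
  by (simp add: upd_def cdot_diff_right cdot_scale_right algebra_simps sum_subtractf
      sum_distrib_left)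

text \<open>The quadratic form equals tau |x|^2 plus the terms a_j |z_j^* x|^2. All positivity below
  descends from here.\<close>

lemma cdot_upd_self:
  assumes "k \<le> s"
  shows "\<exists>r\<ge>0. cdot n x (upd k x) = of_real r"
proof -
  have 1: "cdot n x (upd k x) = \<tau> * cdot n x x + (\<Sum>j<k. a j * cdot n (z j) x * cdot n x (z j))"
    by (simp add: upd_def cdot_add_right cdot_scale_right cdot_sum_right)
  have 2: "cdot n (z j) x * cdot n x (z j) = of_real ((cmod (cdot n (z j) x))\<^sup>2)" for j
    using complex_norm_square[of "cdot n (z j) x"] by (simp add: cnj_cdot)
  have "cdot n x (upd k x) = of_real (\<tau> * (\<Sum>l<n. (cmod (x l))\<^sup>2) +
      (\<Sum>j<k. a j * (cmod (cdot n (z j) x))\<^sup>2))"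
    unfolding 1 by (simp add: cdot_self mult.assoc 2)
  moreover have "0 \<le> \<tau> * (\<Sum>l<n. (cmod (x l))\<^sup>2) + (\<Sum>j<k. a j * (cmod (cdot n (z j) x))\<^sup>2)"
    using tau_pos a_pos assms
    by (intro add_nonneg_nonneg mult_nonneg_nonneg sum_nonneg) (auto intro: less_imp_le)
  ultimately show ?thesis by blast
qed

text \<open>With u = \<open>sol k x\<close>, the number is the conjugate of u^*
  \<open>upd k u\<close>. The inverse property is assumed at a given \<open>x\<close>, so that the
  induction for \<open>upd_sol\<close> can feed in its own hypothesis.\<close>

lemma cdot_sol_self:
  assumes "k \<le> s" "upd k (sol k x) = x"
  shows "\<exists>r\<ge>0. cdot n x (sol k x) = of_real r"
proof -
  obtain r where "r \<ge> 0" "cdot n (sol k x) x = of_real r"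
    using cdot_upd_self[OF assms(1), of "sol k x"] assms(2) by auto
  then show ?thesis using cnj_cdot[of n "sol k x" x] by auto
qed

text \<open>Sherman--Morrison needs a nonzero denominator at each stage. It is nonzero because the
  induction hypothesis makes the previous stage positive, so invertibility and positivity advance
  together.\<close>

lemma upd_sol: "k \<le> s \<Longrightarrow> upd k (sol k x) = x"
proof (induction k arbitrary: x)
  case 0
  then show ?case using tau_pos by (simp add: upd_def)
next
  case (Suc k)
  then have IH: "upd k (sol k x) = x" for x by simp
  obtain r where r: "r \<ge> 0" "cdot n (z k) (sol k (z k)) = of_real r"
    using cdot_sol_self[OF _ IH] Suc.prems by auto
  let ?q = "cdot n (z k) (sol k (z k))"
  have d: "1 + a k * ?q \<noteq> 0"
    using one_plus_neq_0[of "a k" r] r a_pos[of k] Suc.prems by simp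
  show ?case
  proof
    fix l
    let ?u = "cdot n (z k) (sol k x)"
    define c where "c = a k * ?u / (1 + a k * ?q)"
    \<comment> \<open>In this form the correction \<open>- c * z k l\<close> cancels against the new
      rank one term.\<close>
    have e: "a k * ?u = c * (1 + a k * ?q)" using d by (simp add: c_def)
    have "upd (Suc k) (sol (Suc k) x) l = upd k (\<lambda>l. sol k x l - c * sol k (z k) l) l +
        a k * (?u - c * ?q) * z k l"
      unfolding upd_Suc sol.simps c_def[symmetric] cdot_diff_right cdot_scale_right ..
    also have "\<dots> = x l - c * z k l + (a k * ?u - c * (a k * ?q)) * z k l"
      by (subst upd_diff_scale) (simp add: IH algebra_simps)
    finally show "upd (Suc k) (sol (Suc k) x) l = x l"
      by (simp add: e algebra_simps)
  qed
qed

text \<open>Applying the linear functional \<open>cdot n (z i)\<close> turns the recursion of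
  \<open>sol\<close> into that of \<open>sweep\<close>. Vectors of length n thus never have to be
  stored, only their pairwise products.\<close>

lemma sweep_eq_cdot_sol:
  "sweep (\<lambda>i j. cdot n (z i) (z j) / \<tau>) (\<lambda>k. of_real (a k)) k i j = cdot n (z i) (sol k (z j))"
proof (induction k arbitrary: i j)
  case 0
  show ?case by (simp add: cdot_def sum_divide_distrib)
next
  case (Suc k)
  show ?case
    unfolding sweep.simps sol.simps Suc cdot_diff_right cdot_scale_right by (simp add: mult_ac)
qed

section \<open>Determinant and inverse of the matrix behind \<open>upd\<close>\<close>

definition updmat :: "nat \<Rightarrow> complex mat" where
  "updmat k = Matrix.mat n n (\<lambda>(l, m).
     (if l = m then of_real \<tau> else 0) + (\<Sum>j<k. a j * z j l * cnj (z j m)))"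

lemma updmat_carrier [simp]: "updmat k \<in> carrier_mat n n"
  by (simp add: updmat_def)

lemma dim_updmat [simp]: "dim_row (updmat k) = n" "dim_col (updmat k) = n"
  by (simp_all add: updmat_def)

lemma updmat_sum:
  assumes "l < n"
  shows "(\<Sum>m<n. updmat k $$ (l, m) * x m) = upd k x l"
proof -
  have "(\<Sum>m<n. updmat k $$ (l, m) * x m) =
     (\<Sum>m<n. (if l = m then of_real \<tau> * x m else 0) + (\<Sum>j<k. a j * z j l * cnj (z j m) * x m))"
    using assms by (intro sum.cong) (auto simp: updmat_def algebra_simps sum_distrib_left)
  also have "\<dots> = \<tau> * x l + (\<Sum>m<n. \<Sum>j<k. a j * z j l * cnj (z j m) * x m)"
    using assms by (simp add: sum.distrib)
  also have "(\<Sum>m<n. \<Sum>j<k. a j * z j l * cnj (z j m) * x m) = (\<Sum>j<k. a j * cdot n (z j) x * z j l)"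
    by (subst sum.swap) (simp add: cdot_def sum_distrib_left sum_distrib_right mult_ac)
  finally show ?thesis by (simp add: upd_def)
qed

end

text \<open>Matrix determinant lemma, without dividing. The block matrices satisfy L M = N L, where
  L is unit lower triangular and M, N are upper triangular with diagonal blocks A, 1 and 1, D; here
  A is the matrix in question and D = 1 + V U. Comparing determinants gives det A = det D.\<close>

lemma det_one_plus_rank_one:
  fixes u v :: "nat \<Rightarrow> 'a::idom"
  shows "Determinant.det (Matrix.mat n n (\<lambda>(l, m). (if l = m then 1 else 0) + u l * v m)) =
    1 + (\<Sum>l<n. v l * u l)"
proof -
  let ?U = "Matrix.mat n 1 (\<lambda>(l, _). u l)" and ?V = "Matrix.mat 1 n (\<lambda>(_, m). v m)"
  let ?A = "Matrix.mat n n (\<lambda>(l, m). (if l = m then 1 else 0) + u l * v m)"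
  let ?D = "1\<^sub>m 1 + ?V * ?U"
  let ?L = "four_block_mat (1\<^sub>m n) (0\<^sub>m n 1) ?V (1\<^sub>m 1)"
  let ?M = "four_block_mat ?A ?U (0\<^sub>m 1 n) (1\<^sub>m 1)"
  let ?N = "four_block_mat (1\<^sub>m n) ?U (0\<^sub>m 1 n) ?D"
  have A: "?A = 1\<^sub>m n + ?U * ?V" by (rule eq_matI) (auto simp: scalar_prod_def)
  have U: "?U \<in> carrier_mat n 1" and V: "?V \<in> carrier_mat 1 n" by auto
  have 1: "?L * ?M = four_block_mat ?A ?U (?V * ?A) ?D"
    by (subst mult_four_block_mat[of _ n n _ 1 _ 1 _ _ n _ 1])
      (auto intro!: arg_cong2[where f="four_block_mat ?A ?U"])
  have 2: "?N * ?L = four_block_mat ?A ?U (?D * ?V) ?D"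
    unfolding A
    by (subst mult_four_block_mat[of _ n n _ 1 _ 1 _ _ n _ 1]) auto
  have "?V * ?A = ?V * 1\<^sub>m n + ?V * (?U * ?V)"
    unfolding A by (rule mult_add_distrib_mat) auto
  also have "\<dots> = 1\<^sub>m 1 * ?V + ?V * ?U * ?V"
    using assoc_mult_mat[OF V U V] V by simp
  also have "\<dots> = ?D * ?V"
    using V U by (intro add_mult_distrib_mat[symmetric]) auto
  finally have "?L * ?M = ?N * ?L" by (simp only: 1 2)
  moreover have D: "?D \<in> carrier_mat 1 1"
    by (intro add_carrier_mat mult_carrier_mat[OF V U])
  have "?L \<in> carrier_mat (n + 1) (n + 1)" "?M \<in> carrier_mat (n + 1) (n + 1)"
    "?N \<in> carrier_mat (n + 1) (n + 1)"
    using D by (auto intro!: four_block_carrier_mat)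
  note det_mult[OF this(1,2)] det_mult[OF this(3,1)]
  ultimately have "Determinant.det ?L * Determinant.det ?M = Determinant.det ?N * Determinant.det ?L"
    by simp
  moreover have "Determinant.det ?L = 1"
    by (subst det_four_block_mat_upper_right_zero[where n=n and m=1]) auto
  moreover have "Determinant.det ?M = Determinant.det ?A"
    by (subst det_four_block_mat_lower_left_zero[where n=n and m=1]) auto
  moreover have "Determinant.det ?N = Determinant.det ?D"
    by (subst det_four_block_mat_lower_left_zero[where n=n and m=1]) auto
  moreover have "Determinant.det ?D = 1 + (\<Sum>l<n. v l * u l)"
    by (subst det_single) (auto simp: scalar_prod_def lessThan_atLeast0)
  ultimately show ?thesis by (simp only: mult_1 mult_1_right)
qed

context rank_one_updates
begin

lemma det_updmat_0: "Determinant.det (updmat 0) = of_real \<tau> ^ n"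
proof -
  have "updmat 0 = of_real \<tau> \<cdot>\<^sub>m 1\<^sub>m n" by (rule eq_matI) (auto simp: updmat_def)
  then show ?thesis by simp
qed

text \<open>K_{k+1} = K_k X with X = I + a_k u z_k^* and u = K_k^{-1} z_k;
  \<open>det_one_plus_rank_one\<close> evaluates det X.\<close>

lemma det_updmat_Suc:
  assumes "k < s"
  shows "Determinant.det (updmat (Suc k)) =
    Determinant.det (updmat k) * (1 + a k * cdot n (z k) (sol k (z k)))"
proof -
  let ?X = "Matrix.mat n n (\<lambda>(l, m). (if l = m then 1 else 0) + sol k (z k) l * (a k * cnj (z k m)))"
  have "updmat (Suc k) = updmat k * ?X"
  proof (rule eq_matI)
    fix l m assume lm: "l < dim_row (updmat k * ?X)" "m < dim_col (updmat k * ?X)"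
    then have l: "l < n" and m: "m < n" using updmat_carrier[of k] by auto
    have "(updmat k * ?X) $$ (l, m) = (\<Sum>p<n. updmat k $$ (l, p) * ?X $$ (p, m))"
      using l m by (simp add: scalar_prod_def lessThan_atLeast0)
    also have "\<dots> = (\<Sum>p<n. (if p = m then updmat k $$ (l, p) else 0) +
        updmat k $$ (l, p) * sol k (z k) p * (a k * cnj (z k m)))"
      using m by (intro sum.cong) (auto simp: algebra_simps)
    also have "\<dots> = updmat k $$ (l, m) + upd k (sol k (z k)) l * (a k * cnj (z k m))"
      using m updmat_sum[OF l, of k "sol k (z k)"] by (simp add: sum.distrib sum_distrib_right[symmetric])
    also have "upd k (sol k (z k)) l = z k l" using upd_sol[of k "z k"] assms by simp
    finally show "updmat (Suc k) $$ (l, m) = (updmat k * ?X) $$ (l, m)"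
      using l m by (simp add: updmat_def)
  qed (auto simp: updmat_def)
  then have "Determinant.det (updmat (Suc k)) = Determinant.det (updmat k) * Determinant.det ?X"
    by (simp add: det_mult[of _ n])
  moreover have "Determinant.det ?X = 1 + a k * cdot n (z k) (sol k (z k))"
    unfolding det_one_plus_rank_one cdot_def by (simp add: sum_distrib_left mult_ac)
  ultimately show ?thesis by simp
qed

lemma sol_self_real:
  assumes "k \<le> s"
  shows "\<exists>r\<ge>0. cdot n x (sol k x) = of_real r"
  using cdot_sol_self[OF assms upd_sol[OF assms]] .

lemma det_updmat:
  "k \<le> s \<Longrightarrow> Determinant.det (updmat k) =
     of_real (\<tau> ^ n * (\<Prod>j<k. Re (1 + a j * cdot n (z j) (sol j (z j)))))"
proof (induction k)
  case 0
  then show ?case by (simp add: det_updmat_0)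
next
  case (Suc k)
  obtain r where "cdot n (z k) (sol k (z k)) = of_real r"
    using sol_self_real[of k "z k"] Suc.prems by auto
  then show ?case using Suc by (simp add: det_updmat_Suc)
qed

lemma Re_factor_pos:
  assumes "k < s"
  shows "0 < Re (1 + a k * cdot n (z k) (sol k (z k)))"
proof -
  obtain r where "r \<ge> 0" "cdot n (z k) (sol k (z k)) = of_real r"
    using sol_self_real[of k "z k"] assms by auto
  then show ?thesis using a_pos[OF assms] by (simp add: add_pos_nonneg)
qed

lemma ln_det_updmat:
  "ln (Re (Determinant.det (updmat s))) =
     n * ln \<tau> + (\<Sum>k<s. ln (Re (1 + a k * cdot n (z k) (sol k (z k)))))"
proof -
  let ?f = "\<lambda>k. Re (1 + a k * cdot n (z k) (sol k (z k)))"
  have f: "?f k > 0" if "k < s" for k using Re_factor_pos that .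
  have "ln (Re (Determinant.det (updmat s))) = ln (\<tau> ^ n * (\<Prod>k<s. ?f k))"
    by (subst det_updmat) (simp_all only: Re_complex_of_real order_refl)
  also have "\<dots> = ln (\<tau> ^ n) + ln (\<Prod>k<s. ?f k)"
    by (rule ln_mult_pos) (use f tau_pos in \<open>auto intro!: prod_pos simp del: plus_complex.sel\<close>)
  also have "ln (\<Prod>k<s. ?f k) = (\<Sum>k<s. ln (?f k))"
    by (rule ln_prod) (use f in \<open>auto simp: less_le simp del: plus_complex.sel\<close>)
  finally show ?thesis using tau_pos by (simp only: ln_realpow)
qed

text \<open>As the determinant is nonzero, \<open>mat_inverse\<close> returns some B with B K = I,
  and K applied to \<open>sol s x\<close> is x by \<open>upd_sol\<close>.\<close>

lemma mat_inverse_updmat: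
  "the (mat_inverse (updmat s)) *\<^sub>v Matrix.vec n x = Matrix.vec n (sol s x)"
proof -
  have "(\<Prod>j<s. Re (1 + a j * cdot n (z j) (sol j (z j)))) > 0"
    by (rule prod_pos) (use Re_factor_pos in blast)
  then have "\<tau> ^ n * (\<Prod>j<s. Re (1 + a j * cdot n (z j) (sol j (z j)))) \<noteq> 0"
    using tau_pos by (metis less_irrefl mult_pos_pos zero_less_power)
  then have "Determinant.det (updmat s) \<noteq> 0"
    by (subst det_updmat) (simp_all only: of_real_eq_0_iff order_refl not_False_eq_True)
  then have "updmat s \<in> Units (ring_mat TYPE(complex) n undefined)"
    by (rule det_non_zero_imp_unit[OF updmat_carrier])
  then obtain B where B: "mat_inverse (updmat s) = Some B"
    using mat_inverse(1)[OF updmat_carrier[of s], of undefined] by (cases "mat_inverse (updmat s)") auto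
  then have BK: "B * updmat s = 1\<^sub>m n" "B \<in> carrier_mat n n"
    using mat_inverse(2)[OF updmat_carrier B] by auto
  have "updmat s *\<^sub>v Matrix.vec n (sol s x) = Matrix.vec n x"
  proof (rule eq_vecI)
    fix l assume "l < dim_vec (Matrix.vec n x)"
    then have l: "l < n" by simp
    show "(updmat s *\<^sub>v Matrix.vec n (sol s x)) $ l = Matrix.vec n x $ l"
      using updmat_sum[OF l, of s "sol s x"] upd_sol[of s x] l
      by (simp add: scalar_prod_def lessThan_atLeast0)
  qed simp
  then have "B *\<^sub>v Matrix.vec n x = (B * updmat s) *\<^sub>v Matrix.vec n (sol s x)"
    by (subst assoc_mult_mat_vec[OF BK(2) updmat_carrier]) auto
  then show ?thesis using B BK by simp
qed

end

section \<open>Differentiation by slopes\<close>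

text \<open>Plays the role of a neighbourhood filter for Euclidean distance inside
  \<open>Rn m\<close>, which gives access to limit laws and \<open>eventually_elim\<close>. The
  centre is not removed, as suits slopes that are continuous there.\<close>

definition at_Rn :: "nat \<Rightarrow> (nat \<Rightarrow> real) \<Rightarrow> (nat \<Rightarrow> real) filter" where
  "at_Rn m x = inf (filtercomap (\<lambda>v. L2_set (\<lambda>i. v i - x i) {..<m}) (nhds 0)) (principal (Rn m))"

lemma eventually_at_Rn:
  "eventually P (at_Rn m x) \<longleftrightarrow>
     (\<exists>\<delta>>0. \<forall>v\<in>Rn m. L2_set (\<lambda>i. v i - x i) {..<m} < \<delta> \<longrightarrow> P v)"
proof
  assume "eventually P (at_Rn m x)"
  then obtain R where R: "eventually R (nhds (0::real))"
    "\<And>v. R (L2_set (\<lambda>i. v i - x i) {..<m}) \<Longrightarrow> v \<in> Rn m \<Longrightarrow> P v"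
    unfolding at_Rn_def eventually_inf_principal eventually_filtercomap by blast
  then obtain \<delta> where "\<delta> > 0" "\<And>r. dist r 0 < \<delta> \<Longrightarrow> R r"
    unfolding eventually_nhds_metric by blast
  then show "\<exists>\<delta>>0. \<forall>v\<in>Rn m. L2_set (\<lambda>i. v i - x i) {..<m} < \<delta> \<longrightarrow> P v"
    using R(2) by (intro exI[of _ \<delta>]) (auto simp: dist_real_def L2_set_nonneg)
next
  assume "\<exists>\<delta>>0. \<forall>v\<in>Rn m. L2_set (\<lambda>i. v i - x i) {..<m} < \<delta> \<longrightarrow> P v"
  then obtain \<delta> where \<delta>: "\<delta> > 0"
    "\<And>v. v \<in> Rn m \<Longrightarrow> L2_set (\<lambda>i. v i - x i) {..<m} < \<delta> \<Longrightarrow> P v" by blast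
  have "eventually (\<lambda>r. r < \<delta>) (nhds (0::real))"
    using \<delta>(1) by (metis eventually_nhds lessThan_iff open_lessThan)
  then show "eventually P (at_Rn m x)"
    unfolding at_Rn_def eventually_inf_principal eventually_filtercomap using \<delta>(2) by blast
qed

lemma abs_le_L2_set:
  assumes "i < (m::nat)"
  shows "\<bar>f i\<bar> \<le> L2_set f {..<m}"
proof -
  have "(f i)\<^sup>2 \<le> (\<Sum>i<m. (f i)\<^sup>2)"
    by (rule member_le_sum) (use assms in auto)
  then show ?thesis by (metis L2_set_def real_sqrt_abs real_sqrt_le_mono)
qed

lemma tendsto_coordinate_at_Rn:
  assumes "i < m"
  shows "((\<lambda>v. v i) \<longlongrightarrow> x i) (at_Rn m x)"
proof (rule tendstoI)
  fix e :: real assume "e > 0"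
  have "\<bar>v i - x i\<bar> \<le> L2_set (\<lambda>i. v i - x i) {..<m}" for v
    using abs_le_L2_set[OF assms] .
  then show "\<forall>\<^sub>F v in at_Rn m x. dist (v i) (x i) < e"
    unfolding eventually_at_Rn dist_real_def using \<open>e > 0\<close> by (meson le_less_trans)
qed

text \<open>
  Caratheodory's form of differentiability: the increment is a combination of coordinate
  increments with slopes that converge to the gradient. It turns the differentiation rules
  into algebraic identities.
\<close>

definition has_slopes ::
    "nat \<Rightarrow> ((nat \<Rightarrow> real) \<Rightarrow> 'a::real_normed_field) \<Rightarrow> (nat \<Rightarrow> 'a) \<Rightarrow> (nat \<Rightarrow> real) \<Rightarrow> bool" where
  "has_slopes m f g x \<longleftrightarrow> (\<exists>\<phi>. (\<forall>i<m. (\<phi> i \<longlongrightarrow> g i) (at_Rn m x)) \<and>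
     (\<forall>\<^sub>F v in at_Rn m x. f v = f x + (\<Sum>i<m. \<phi> i v * of_real (v i - x i))))"

lemma has_slopesI:
  assumes "\<And>i. i < m \<Longrightarrow> (\<phi> i \<longlongrightarrow> g i) (at_Rn m x)"
    "\<forall>\<^sub>F v in at_Rn m x. f v = f x + (\<Sum>i<m. \<phi> i v * of_real (v i - x i))"
  shows "has_slopes m f g x"
  unfolding has_slopes_def using assms by blast

lemma has_slopesE:
  assumes "has_slopes m f g x"
  obtains \<phi> where "\<forall>i<m. (\<phi> i \<longlongrightarrow> g i) (at_Rn m x)"
    "\<forall>\<^sub>F v in at_Rn m x. f v = f x + (\<Sum>i<m. \<phi> i v * of_real (v i - x i))"
  using assms unfolding has_slopes_def by blast

lemma has_slopes_tendsto:
  assumes "has_slopes m f g x"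
  shows "(f \<longlongrightarrow> f x) (at_Rn m x)"
proof -
  obtain \<phi> where \<phi>: "\<forall>i<m. (\<phi> i \<longlongrightarrow> g i) (at_Rn m x)"
    and e: "\<forall>\<^sub>F v in at_Rn m x. f v = f x + (\<Sum>i<m. \<phi> i v * of_real (v i - x i))"
    by (rule has_slopesE[OF assms])
  note \<phi> = \<phi>[rule_format]
  have "((\<lambda>v. f x + (\<Sum>i<m. \<phi> i v * of_real (v i - x i))) \<longlongrightarrow>
      f x + (\<Sum>i<m. g i * of_real (x i - x i))) (at_Rn m x)"
    by (intro tendsto_intros \<phi> tendsto_coordinate_at_Rn) auto
  then show ?thesis by (simp add: tendsto_cong[OF e])
qed

lemma has_slopes_cong:
  assumes "has_slopes m f g x" "\<forall>\<^sub>F v in at_Rn m x. f' v = f v" "f' x = f x"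
    "\<And>i. i < m \<Longrightarrow> g' i = g i"
  shows "has_slopes m f' g' x"
proof -
  obtain \<phi> where \<phi>: "\<forall>i<m. (\<phi> i \<longlongrightarrow> g i) (at_Rn m x)"
    and e: "\<forall>\<^sub>F v in at_Rn m x. f v = f x + (\<Sum>i<m. \<phi> i v * of_real (v i - x i))"
    by (rule has_slopesE[OF assms(1)])
  note \<phi> = \<phi>[rule_format]
  show ?thesis
  proof (rule has_slopesI[of _ \<phi>])
    show "\<forall>\<^sub>F v in at_Rn m x. f' v = f' x + (\<Sum>i<m. \<phi> i v * of_real (v i - x i))"
      using e assms(2) by eventually_elim (simp add: assms(3))
  qed (use \<phi> assms(4) in auto)
qed

lemma has_slopes_eq:
  assumes "has_slopes m f g x" "\<And>i. i < m \<Longrightarrow> g' i = g i"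
  shows "has_slopes m f g' x"
  by (rule has_slopes_cong[OF assms(1)]) (use assms(2) in auto)

lemma has_slopes_const: "has_slopes m (\<lambda>_. c) (\<lambda>_. 0) x"
  by (rule has_slopesI[of _ "\<lambda>_ _. 0"]) auto

lemma has_slopes_coordinate:
  assumes "k < m"
  shows "has_slopes m (\<lambda>v. of_real (v k)) (\<lambda>i. if i = k then 1 else 0) x"
proof (rule has_slopesI[of _ "\<lambda>i _. if i = k then 1 else 0"])
  have "(\<Sum>i<m. (if i = k then 1 else 0) * of_real (v i - x i) :: 'a) = of_real (v k - x k)" for v :: "nat \<Rightarrow> real"
    using assms by (simp add: if_distrib[of "\<lambda>c. c * _"] cong: if_cong)
  then show "\<forall>\<^sub>F v in at_Rn m x. of_real (v k) =
      of_real (x k) + (\<Sum>i<m. (if i = k then 1 else 0) * of_real (v i - x i) :: 'a)"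
    by simp
qed auto

lemma has_slopes_add:
  assumes "has_slopes m f g x" "has_slopes m f' g' x"
  shows "has_slopes m (\<lambda>v. f v + f' v) (\<lambda>i. g i + g' i) x"
proof -
  obtain \<phi> where \<phi>: "\<forall>i<m. (\<phi> i \<longlongrightarrow> g i) (at_Rn m x)"
    and e: "\<forall>\<^sub>F v in at_Rn m x. f v = f x + (\<Sum>i<m. \<phi> i v * of_real (v i - x i))"
    by (rule has_slopesE[OF assms(1)])
  note \<phi> = \<phi>[rule_format]
  obtain \<psi> where \<psi>: "\<forall>i<m. (\<psi> i \<longlongrightarrow> g' i) (at_Rn m x)"
    and e': "\<forall>\<^sub>F v in at_Rn m x. f' v = f' x + (\<Sum>i<m. \<psi> i v * of_real (v i - x i))"
    by (rule has_slopesE[OF assms(2)])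
  note \<psi> = \<psi>[rule_format]
  show ?thesis
  proof (rule has_slopesI[of _ "\<lambda>i v. \<phi> i v + \<psi> i v"])
    show "\<forall>\<^sub>F v in at_Rn m x. f v + f' v =
        f x + f' x + (\<Sum>i<m. (\<phi> i v + \<psi> i v) * of_real (v i - x i))"
      using e e' by eventually_elim (simp add: distrib_right sum.distrib)
  qed (intro tendsto_add \<phi> \<psi>)
qed

lemma has_slopes_mult:
  assumes "has_slopes m f g x" "has_slopes m f' g' x"
  shows "has_slopes m (\<lambda>v. f v * f' v) (\<lambda>i. g i * f' x + f x * g' i) x"
proof -
  obtain \<phi> where \<phi>: "\<forall>i<m. (\<phi> i \<longlongrightarrow> g i) (at_Rn m x)"
    and e: "\<forall>\<^sub>F v in at_Rn m x. f v = f x + (\<Sum>i<m. \<phi> i v * of_real (v i - x i))"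
    by (rule has_slopesE[OF assms(1)])
  note \<phi> = \<phi>[rule_format]
  obtain \<psi> where \<psi>: "\<forall>i<m. (\<psi> i \<longlongrightarrow> g' i) (at_Rn m x)"
    and e': "\<forall>\<^sub>F v in at_Rn m x. f' v = f' x + (\<Sum>i<m. \<psi> i v * of_real (v i - x i))"
    by (rule has_slopesE[OF assms(2)])
  note \<psi> = \<psi>[rule_format]
  show ?thesis
  \<comment> \<open>These slopes come from f v f' v - f x f' x = (f v - f x) f' x + f v (f' v - f'
    x).\<close>
  proof (rule has_slopesI[of _ "\<lambda>i v. \<phi> i v * f' x + f v * \<psi> i v"])
    show "\<forall>\<^sub>F v in at_Rn m x. f v * f' v =
        f x * f' x + (\<Sum>i<m. (\<phi> i v * f' x + f v * \<psi> i v) * of_real (v i - x i))"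
      using e e'
    proof eventually_elim
      case (elim v)
      have *: "(\<Sum>i<m. \<phi> i v * of_real (v i - x i)) = f v - f x"
        "(\<Sum>i<m. \<psi> i v * of_real (v i - x i)) = f' v - f' x"
        using elim by (metis add_diff_cancel_left')+
      have "(\<Sum>i<m. (\<phi> i v * f' x + f v * \<psi> i v) * of_real (v i - x i)) =
          (\<Sum>i<m. \<phi> i v * of_real (v i - x i)) * f' x + f v * (\<Sum>i<m. \<psi> i v * of_real (v i - x i))"
        by (simp add: distrib_right distrib_left sum.distrib sum_distrib_left sum_distrib_right mult_ac del: of_real_diff)
      then show ?case unfolding * by (simp add: algebra_simps)
    qed
  qed (intro tendsto_intros \<phi> \<psi> has_slopes_tendsto[OF assms(1)])
qed

lemma has_slopes_cmult:
  "has_slopes m f g x \<Longrightarrow> has_slopes m (\<lambda>v. c * f v) (\<lambda>i. c * g i) x"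
  using has_slopes_mult[OF has_slopes_const[of m c x]] by (rule has_slopes_eq) auto

lemma has_slopes_diff:
  assumes "has_slopes m f g x" "has_slopes m f' g' x"
  shows "has_slopes m (\<lambda>v. f v - f' v) (\<lambda>i. g i - g' i) x"
  using has_slopes_add[OF assms(1) has_slopes_cmult[OF assms(2), of "-1"]] by simp

lemma has_slopes_inverse:
  assumes "has_slopes m f g x" "f x \<noteq> 0"
  shows "has_slopes m (\<lambda>v. inverse (f v)) (\<lambda>i. - g i / (f x)\<^sup>2) x"
proof -
  obtain \<phi> where \<phi>: "\<forall>i<m. (\<phi> i \<longlongrightarrow> g i) (at_Rn m x)"
    and e: "\<forall>\<^sub>F v in at_Rn m x. f v = f x + (\<Sum>i<m. \<phi> i v * of_real (v i - x i))"
    by (rule has_slopesE[OF assms(1)])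
  note \<phi> = \<phi>[rule_format]
  note f = has_slopes_tendsto[OF assms(1)]
  have nz: "\<forall>\<^sub>F v in at_Rn m x. f v \<noteq> 0"
    using tendsto_imp_eventually_ne[OF f assms(2)] .
  show ?thesis
  proof (rule has_slopesI[of _ "\<lambda>i v. - \<phi> i v / (f v * f x)"])
    show "((\<lambda>v. - \<phi> i v / (f v * f x)) \<longlongrightarrow> - g i / (f x)\<^sup>2) (at_Rn m x)" if "i < m" for i
      unfolding power2_eq_square using assms(2) by (intro tendsto_intros \<phi> f that) auto
    show "\<forall>\<^sub>F v in at_Rn m x. inverse (f v) =
        inverse (f x) + (\<Sum>i<m. - \<phi> i v / (f v * f x) * of_real (v i - x i))"
      using e nz
    proof eventually_elim
      case (elim v)
      have *: "(\<Sum>i<m. \<phi> i v * of_real (v i - x i)) = f v - f x"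
        using elim(1) by (metis add_diff_cancel_left')
      have "(\<Sum>i<m. - \<phi> i v / (f v * f x) * of_real (v i - x i)) =
          - (\<Sum>i<m. \<phi> i v * of_real (v i - x i)) / (f v * f x)"
        by (simp add: sum_divide_distrib sum_negf)
      also have "\<dots> = inverse (f v) - inverse (f x)"
        unfolding * using elim(2) assms(2) by (simp add: field_simps)
      finally show ?case by simp
    qed
  qed
qed

lemma has_slopes_divide:
  assumes "has_slopes m f g x" "has_slopes m f' g' x" "f' x \<noteq> 0"
  shows "has_slopes m (\<lambda>v. f v / f' v) (\<lambda>i. g i / f' x - f x * g' i / (f' x)\<^sup>2) x"
  using has_slopes_mult[OF assms(1) has_slopes_inverse[OF assms(2,3)]]
  by (simp add: divide_inverse mult.assoc)

lemma has_slopes_Re: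
  assumes "has_slopes m f g x"
  shows "has_slopes m (\<lambda>v. Re (f v)) (\<lambda>i. Re (g i)) x"
proof -
  obtain \<phi> where \<phi>: "\<forall>i<m. (\<phi> i \<longlongrightarrow> g i) (at_Rn m x)"
    and e: "\<forall>\<^sub>F v in at_Rn m x. f v = f x + (\<Sum>i<m. \<phi> i v * of_real (v i - x i))"
    by (rule has_slopesE[OF assms(1)])
  note \<phi> = \<phi>[rule_format]
  show ?thesis
  proof (rule has_slopesI[of _ "\<lambda>i v. Re (\<phi> i v)"])
    show "\<forall>\<^sub>F v in at_Rn m x. Re (f v) = Re (f x) + (\<Sum>i<m. Re (\<phi> i v) * of_real (v i - x i))"
      using e by eventually_elim (simp del: of_real_diff)
  qed (intro tendsto_Re \<phi>)
qed

lemma has_slopes_of_real: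
  assumes "has_slopes m f g x"
  shows "has_slopes m (\<lambda>v. of_real (f v) :: 'a::{real_normed_field}) (\<lambda>i. of_real (g i)) x"
proof -
  obtain \<phi> where \<phi>: "\<forall>i<m. (\<phi> i \<longlongrightarrow> g i) (at_Rn m x)"
    and e: "\<forall>\<^sub>F v in at_Rn m x. f v = f x + (\<Sum>i<m. \<phi> i v * of_real (v i - x i))"
    by (rule has_slopesE[OF assms(1)])
  note \<phi> = \<phi>[rule_format]
  show ?thesis
  proof (rule has_slopesI[of _ "\<lambda>i v. of_real (\<phi> i v)"])
    show "\<forall>\<^sub>F v in at_Rn m x.
        (of_real (f v) :: 'a) = of_real (f x) + (\<Sum>i<m. of_real (\<phi> i v) * of_real (v i - x i))"
      using e by eventually_elim simp
  qed (intro tendsto_of_real \<phi>)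
qed

lemma has_slopes_DERIV:
  fixes f :: "(nat \<Rightarrow> real) \<Rightarrow> real"
  assumes "has_slopes m f g x" "(F has_field_derivative D) (at (f x))"
  shows "has_slopes m (\<lambda>v. F (f v)) (\<lambda>i. D * g i) x"
proof -
  obtain \<phi> where \<phi>: "\<forall>i<m. (\<phi> i \<longlongrightarrow> g i) (at_Rn m x)"
    and e: "\<forall>\<^sub>F v in at_Rn m x. f v = f x + (\<Sum>i<m. \<phi> i v * of_real (v i - x i))"
    by (rule has_slopesE[OF assms(1)])
  note \<phi> = \<phi>[rule_format]
  obtain c where c: "\<And>y. F y - F (f x) = c y * (y - f x)" "isCont c (f x)" "c (f x) = D"
    using assms(2) unfolding CARAT_DERIV by blast
  have cl: "((\<lambda>v. c (f v)) \<longlongrightarrow> D) (at_Rn m x)"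
    using isCont_tendsto_compose[OF c(2) has_slopes_tendsto[OF assms(1)]] c(3) by simp
  show ?thesis
  proof (rule has_slopesI[of _ "\<lambda>i v. c (f v) * \<phi> i v"])
    show "\<forall>\<^sub>F v in at_Rn m x. F (f v) = F (f x) + (\<Sum>i<m. c (f v) * \<phi> i v * of_real (v i - x i))"
      using e
    proof eventually_elim
      case (elim v)
      then have "(\<Sum>i<m. \<phi> i v * of_real (v i - x i)) = f v - f x"
        by (metis add_diff_cancel_left')
      then have "(\<Sum>i<m. c (f v) * \<phi> i v * of_real (v i - x i)) = c (f v) * (f v - f x)"
        by (simp add: mult.assoc sum_distrib_left[symmetric] del: of_real_diff)
      then show ?case using c(1)[of "f v"] by simp
    qed
  qed (intro tendsto_mult cl \<phi>)
qed

lemma has_gradient_imp_has_slopes: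
  assumes "has_gradient m f g x" "x \<in> Rn m"
  shows "has_slopes m f g x"
proof -
  define r where "r v = L2_set (\<lambda>i. v i - x i) {..<m}" for v
  define err where "err v = f v - f x - (\<Sum>i<m. g i * (v i - x i))" for v
  \<comment> \<open>The remainder is shared out in proportion to the increments. Their squares sum
    to (r v)^2, so the corrections add up to exactly \<open>err v\<close>, and each is at most |err
    v| / r v, which is small. At distance 0 the slope is just \<open>g i\<close>.\<close>
  define \<phi> where "\<phi> i v = g i + err v / (r v)\<^sup>2 * (v i - x i)" for i v
  have r0: "0 \<le> r v" for v by (simp add: r_def L2_set_nonneg)
  have le: "\<bar>v i - x i\<bar> \<le> r v" if "i < m" for i v
    unfolding r_def using abs_le_L2_set[OF that] .
  have sq: "(\<Sum>i<m. (v i - x i)\<^sup>2) = (r v)\<^sup>2" for v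
    by (simp add: r_def L2_set_def sum_nonneg)
  show ?thesis
  proof (rule has_slopesI[of _ \<phi>])
    fix i assume "i < m"
    show "(\<phi> i \<longlongrightarrow> g i) (at_Rn m x)"
    proof (rule tendstoI)
      fix e :: real assume "e > 0"
      then obtain \<delta> where \<delta>: "\<delta> > 0" "\<And>v. v \<in> Rn m \<Longrightarrow> r v < \<delta> \<Longrightarrow> \<bar>err v\<bar> \<le> e / 2 * r v"
        using assms(1) unfolding has_gradient_def r_def err_def by (meson half_gt_zero)
      have "dist (\<phi> i v) (g i) < e" if "v \<in> Rn m" "r v < \<delta>" for v
      proof (cases "r v = 0")
        case False
        then have "r v > 0" using r0[of v] by simp
        have "dist (\<phi> i v) (g i) = \<bar>err v\<bar> * \<bar>v i - x i\<bar> / (r v)\<^sup>2"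
          by (simp add: \<phi>_def dist_real_def abs_mult)
        also have "\<dots> \<le> (e / 2 * r v) * r v / (r v)\<^sup>2"
          using \<delta>(2)[OF that] le[OF \<open>i < m\<close>, of v] r0[of v] \<open>e > 0\<close>
          by (intro divide_right_mono mult_mono) auto
        also have "\<dots> = e / 2" using \<open>r v > 0\<close> by (simp add: power2_eq_square)
        finally show ?thesis using \<open>e > 0\<close> by simp
      qed (use \<open>e > 0\<close> in \<open>simp add: \<phi>_def\<close>)
      then show "\<forall>\<^sub>F v in at_Rn m x. dist (\<phi> i v) (g i) < e"
        unfolding eventually_at_Rn r_def[symmetric] by (intro exI[of _ \<delta>] conjI \<delta>(1)) simp
    qed
  next
    have "f v = f x + (\<Sum>i<m. \<phi> i v * of_real (v i - x i))" if "v \<in> Rn m" for v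
    proof (cases "r v = 0")
      case True
      then have "v i = x i" if "i < m" for i using le[OF that, of v] by simp
      \<comment> \<open>Distance 0 only gives agreement below \<open>m\<close>; membership of both
        points in \<open>Rn m\<close> settles the remaining indices.\<close>
      then have "v = x" by (intro PiE_ext[OF \<open>v \<in> Rn m\<close> assms(2)]) simp
      then show ?thesis by simp
    next
      case False
      have "(\<Sum>i<m. \<phi> i v * of_real (v i - x i)) =
          (\<Sum>i<m. g i * (v i - x i)) + err v / (r v)\<^sup>2 * (\<Sum>i<m. (v i - x i)\<^sup>2)"
        by (simp add: \<phi>_def distrib_right sum.distrib sum_distrib_left power2_eq_square mult.assoc)
      also have "\<dots> = f v - f x" using False by (simp add: sq err_def)
      finally show ?thesis by simp
    qed
    then show "\<forall>\<^sub>F v in at_Rn m x. f v = f x + (\<Sum>i<m. \<phi> i v * of_real (v i - x i))"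
      unfolding eventually_at_Rn by (intro exI[of _ 1]) simp
  qed
qed

text \<open>The remainder is the sum of (phi_i - g_i) (v_i - x_i), hence at most the distance times
  the sum of |phi_i - g_i|, which tends to 0.\<close>

lemma has_slopes_imp_has_gradient:
  assumes "has_slopes m f g x"
  shows "has_gradient m f g x"
  unfolding has_gradient_def
proof (intro allI impI)
  fix e :: real assume "e > 0"
  obtain \<phi> where \<phi>: "\<forall>i<m. (\<phi> i \<longlongrightarrow> g i) (at_Rn m x)"
    and e: "\<forall>\<^sub>F v in at_Rn m x. f v = f x + (\<Sum>i<m. \<phi> i v * of_real (v i - x i))"
    by (rule has_slopesE[OF assms(1)])
  note \<phi> = \<phi>[rule_format]
  have "((\<lambda>v. \<Sum>i<m. \<bar>\<phi> i v - g i\<bar>) \<longlongrightarrow> (\<Sum>i<m. \<bar>g i - g i\<bar>)) (at_Rn m x)"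
    by (intro tendsto_intros \<phi>) auto
  then have "\<forall>\<^sub>F v in at_Rn m x. (\<Sum>i<m. \<bar>\<phi> i v - g i\<bar>) < e"
    using \<open>e > 0\<close> order_tendstoD(2) by fastforce
  with e have "\<forall>\<^sub>F v in at_Rn m x. \<bar>f v - f x - (\<Sum>i<m. g i * (v i - x i))\<bar> \<le>
      e * L2_set (\<lambda>i. v i - x i) {..<m}"
  proof eventually_elim
    case (elim v)
    let ?r = "L2_set (\<lambda>i. v i - x i) {..<m}"
    have le: "\<bar>v i - x i\<bar> \<le> ?r" if "i < m" for i
      using abs_le_L2_set[OF that] .
    have "f v - f x - (\<Sum>i<m. g i * (v i - x i)) = (\<Sum>i<m. (\<phi> i v - g i) * (v i - x i))"
      using elim(1) by (simp add: left_diff_distrib sum_subtractf)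
    also have "\<bar>\<dots>\<bar> \<le> (\<Sum>i<m. \<bar>\<phi> i v - g i\<bar> * ?r)"
      by (rule order_trans[OF sum_abs]) (auto intro!: sum_mono mult_left_mono le simp: abs_mult)
    also have "\<dots> \<le> e * ?r"
      unfolding sum_distrib_right[symmetric] using elim(2)
      by (intro mult_right_mono) (auto simp: L2_set_nonneg)
    finally show ?case .
  qed
  then show "\<exists>\<delta>>0. \<forall>v\<in>Rn m. L2_set (\<lambda>i. v i - x i) {..<m} < \<delta> \<longrightarrow>
      \<bar>f v - f x - (\<Sum>i<m. g i * (v i - x i))\<bar> \<le> e * L2_set (\<lambda>i. v i - x i) {..<m}"
    unfolding eventually_at_Rn .
qed

text \<open>Links what \<open>DDens\<close> reads, a one-variable derivative, to the gradient whose
  mere existence the model grants. Along x(i := t) all other increments vanish.\<close>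

lemma has_gradient_partial_deriv:
  assumes "has_gradient m f g x" "x \<in> Rn m" "i < m"
  shows "partial_deriv f i x = g i"
proof -
  obtain \<phi> where \<phi>: "\<forall>i<m. (\<phi> i \<longlongrightarrow> g i) (at_Rn m x)"
    and e: "\<forall>\<^sub>F v in at_Rn m x. f v = f x + (\<Sum>i<m. \<phi> i v * of_real (v i - x i))"
    by (rule has_slopesE[OF has_gradient_imp_has_slopes[OF assms(1,2)]])
  note \<phi> = \<phi>[rule_format]
  have r: "L2_set (\<lambda>j. (x(i := t)) j - x j) {..<m} = \<bar>t - x i\<bar>" for t
  proof -
    have "(\<Sum>j<m. ((x(i := t)) j - x j)\<^sup>2) = (\<Sum>j<m. if j = i then (t - x i)\<^sup>2 else 0)"
      by (intro sum.cong) auto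
    then show ?thesis using assms(3) by (simp add: L2_set_def)
  qed
  have lim: "filterlim (\<lambda>t. x(i := t)) (at_Rn m x) (at (x i))"
    unfolding filterlim_iff
  proof (intro allI impI)
    fix P assume "eventually P (at_Rn m x)"
    then obtain \<delta> where "\<delta> > 0" "\<And>v. v \<in> Rn m \<Longrightarrow> L2_set (\<lambda>i. v i - x i) {..<m} < \<delta> \<Longrightarrow> P v"
      unfolding eventually_at_Rn by blast
    moreover have "x(i := t) \<in> Rn m" for t
      using assms(2,3) by (auto simp: PiE_iff extensional_def)
    ultimately show "\<forall>\<^sub>F t in at (x i). P (x(i := t))"
      unfolding eventually_at using r by (auto simp: dist_real_def)
  qed
  have "\<forall>\<^sub>F t in at (x i). t \<noteq> x i" by (simp add: eventually_at_filter)
  with filterlim_iff[THEN iffD1, OF lim, rule_format, OF e]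
  have "\<forall>\<^sub>F t in at (x i). (f (x(i := t)) - f x) / (t - x i) = \<phi> i (x(i := t))"
  proof eventually_elim
    case (elim t)
    have "(\<Sum>j<m. \<phi> j (x(i := t)) * of_real ((x(i := t)) j - x j)) =
        (\<Sum>j<m. if j = i then \<phi> i (x(i := t)) * (t - x i) else 0)"
      by (intro sum.cong) auto
    then show ?case using elim assms(3) by simp
  qed
  moreover have "((\<lambda>t. \<phi> i (x(i := t))) \<longlongrightarrow> g i) (at (x i))"
    using filterlim_compose[OF \<phi>[OF assms(3)] lim] .
  ultimately have "((\<lambda>t. (f (x(i := t)) - f x) / (t - x i)) \<longlongrightarrow> g i) (at (x i))"
    by (simp add: tendsto_cong)
  then have "((\<lambda>t. f (x(i := t))) has_field_derivative g i) (at (x i))"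
    by (simp add: has_field_derivative_iff)
  then show ?thesis unfolding partial_deriv_def by (rule DERIV_imp_deriv)
qed

section \<open>Derivatives along the rank one updates\<close>

text \<open>In row or column k the update u - a u q / (1 + a q) collapses to u / (1 + a q).\<close>

lemma sweep_Suc_index:
  assumes "1 + a k * sweep q a k k k \<noteq> 0"
  shows "sweep q a (Suc k) i k = sweep q a k i k / (1 + a k * sweep q a k k k)"
    "sweep q a (Suc k) k j = sweep q a k k j / (1 + a k * sweep q a k k k)"
  using assms by (simp_all add: field_simps)

text \<open>The algebra of one induction step. Here y, u, v, q stand for Q_ij, Q_ik, Q_kj, Q_kk at
  stage k, b for the denominator, c for a / b and t for d tau / tau; the S and T are the bilinear
  sums with weights da_l and a_l. The left side is the closed formula at stage k + 1, the right side
  the quotient rule applied to the recursion.\<close>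

lemma sweep_derivative_step:
  fixes a :: "'a::field"
  assumes "b \<noteq> 0" "a = c * b" "1 / b = 1 - c * q"
  shows "- (Sij - c * v * Sik - c * u * Skj + c\<^sup>2 * u * v * Skk + da * (u / b) * (v / b)) -
      t * (y - c * u * v - (Tij - c * v * Tik - c * u * Tkj + c\<^sup>2 * u * v * Tkk + a * (u / b) * (v / b))) =
    (- Sij - t * (y - Tij)) - (((da * u + a * (- Sik - t * (u - Tik))) * v +
        a * u * (- Skj - t * (v - Tkj))) / b -
      a * u * v * (0 + (da * q + a * (- Skk - t * (q - Tkk)))) / b\<^sup>2)"
proof -
  \<comment> \<open>Every a on which the claim depends comes with a factor 1 / b. Replacing the
    product by c and any further 1 / b by 1 - c q leaves a polynomial identity.\<close>
  define \<beta> where "\<beta> = 1 / b"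
  have b: "x / b = x * \<beta>" "x / b\<^sup>2 = x * \<beta> * \<beta>" for x
    by (simp_all add: \<beta>_def power2_eq_square)
  have a: "a * \<beta> = c" using assms(1,2) by (simp add: \<beta>_def)
  have \<beta>: "\<beta> = 1 - c * q" using assms(3) by (simp add: \<beta>_def)
  have 1: "a * (u * \<beta>) * (v * \<beta>) = (a * \<beta>) * \<beta> * u * v"
    by (simp add: mult_ac)
  have 2: "((da * u + a * X) * v + a * u * Y) * \<beta> = da * u * v * \<beta> + (a * \<beta>) * (X * v + u * Y)" for X Y
    by (simp add: algebra_simps)
  have 3: "a * u * v * (0 + (da * q + a * X)) * \<beta> * \<beta> =
      u * v * (da * q * (a * \<beta>) * \<beta> + (a * \<beta>) * (a * \<beta>) * X)" for X
    by (simp add: algebra_simps)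
  show ?thesis
    unfolding b unfolding 1 2 3 unfolding a unfolding \<beta> by (simp add: algebra_simps power2_eq_square)
qed

text \<open>
  The formulas are those of \<open>d(K\<^sup>-\<^sup>1) = - K\<^sup>-\<^sup>1 (dK) K\<^sup>-\<^sup>1\<close> and \<open>d(log det K) = tr (K\<^sup>-\<^sup>1 dK)\<close>, with the
  contribution of the identity rewritten by \<open>\<tau> K\<^sup>-\<^sup>1 = I - \<Sum> a\<^sub>l K\<^sup>-\<^sup>1 z\<^sub>l z\<^sub>l\<^sup>*\<close>; both are
  consequences of the recursion for \<^const>\<open>sweep\<close>.
\<close>

lemma has_slopes_sweep:
  fixes G :: "nat \<Rightarrow> nat \<Rightarrow> complex" and \<tau> :: "(nat \<Rightarrow> real) \<Rightarrow> complex"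
    and a :: "nat \<Rightarrow> (nat \<Rightarrow> real) \<Rightarrow> complex"
  defines "Q \<equiv> \<lambda>k v. sweep (\<lambda>i j. G i j / \<tau> v) (\<lambda>l. a l v) k"
  assumes \<tau>: "has_slopes m \<tau> d\<tau> x" "\<tau> x \<noteq> 0"
    and a: "\<And>k. k < s \<Longrightarrow> has_slopes m (a k) (da k) x"
    and nz: "\<And>k. k < s \<Longrightarrow> 1 + a k x * Q k x k k \<noteq> 0"
    and "k \<le> s"
  shows "has_slopes m (\<lambda>v. Q k v i j)
    (\<lambda>p. - (\<Sum>l<k. da l p * Q k x i l * Q k x l j) -
       d\<tau> p / \<tau> x * (Q k x i j - (\<Sum>l<k. a l x * Q k x i l * Q k x l j))) x"
  using \<open>k \<le> s\<close>
proof (induction k arbitrary: i j)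
  case 0
  have "has_slopes m (\<lambda>v. G i j / \<tau> v) (\<lambda>p. 0 / \<tau> x - G i j * d\<tau> p / (\<tau> x)\<^sup>2) x"
    by (intro has_slopes_divide has_slopes_const \<tau>)
  then show ?case
    by (simp add: Q_def) (erule has_slopes_eq, simp add: power2_eq_square mult.commute)
next
  case (Suc k)
  then have k: "k < s" by simp
  let ?q = "Q k x"
  define D where "D i j p = - (\<Sum>l<k. da l p * ?q i l * ?q l j) -
       d\<tau> p / \<tau> x * (?q i j - (\<Sum>l<k. a l x * ?q i l * ?q l j))" for i j p
  have IH: "has_slopes m (\<lambda>v. Q k v i j) (D i j) x" for i j
    unfolding D_def using Suc.IH k by simp
  define b where "b = 1 + a k x * ?q k k"
  have b: "b \<noteq> 0" using nz[OF k] by (simp add: b_def)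
  define c where "c = a k x / b"
  have Q': "Q (Suc k) x i j = ?q i j - c * ?q i k * ?q k j" for i j
    by (simp add: Q_def c_def b_def)
  have Qk: "Q (Suc k) x i k = ?q i k / b" "Q (Suc k) x k j = ?q k j / b" for i j
    using sweep_Suc_index[of "\<lambda>l. a l x" k "\<lambda>i j. G i j / \<tau> x"] nz[OF k] by (simp_all add: Q_def b_def)
  have "has_slopes m (\<lambda>v. Q k v i j - a k v * Q k v i k * Q k v k j / (1 + a k v * Q k v k k))
      (\<lambda>p. D i j p - (((da k p * ?q i k + a k x * D i k p) * ?q k j + a k x * ?q i k * D k j p) / b -
         a k x * ?q i k * ?q k j * (0 + (da k p * ?q k k + a k x * D k k p)) / b\<^sup>2)) x"
    unfolding b_def using nz[OF k]
    by (intro has_slopes_diff has_slopes_divide has_slopes_mult has_slopes_add has_slopes_const IH a k)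
  moreover have "(\<lambda>v. Q k v i j - a k v * Q k v i k * Q k v k j / (1 + a k v * Q k v k k)) =
      (\<lambda>v. Q (Suc k) v i j)"
    by (simp add: Q_def)
  ultimately have "has_slopes m (\<lambda>v. Q (Suc k) v i j)
      (\<lambda>p. D i j p - (((da k p * ?q i k + a k x * D i k p) * ?q k j + a k x * ?q i k * D k j p) / b -
         a k x * ?q i k * ?q k j * (0 + (da k p * ?q k k + a k x * D k k p)) / b\<^sup>2)) x"
    by simp
  then show ?case
  proof (rule has_slopes_eq)
    \<comment> \<open>The quotient rule has produced a derivative; it remains to see that it is the
      closed formula at stage k + 1.\<close>
    fix p
    define S where "S i j w = (\<Sum>l<k. w l * ?q i l * ?q l j)" for i j and w :: "nat \<Rightarrow> complex"
    have S: "(\<Sum>l<k. w l * Q (Suc k) x i l * Q (Suc k) x l j) =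
        S i j w - c * ?q k j * S i k w - c * ?q i k * S k j w + c\<^sup>2 * ?q i k * ?q k j * S k k w" for w
    proof -
      have "(\<Sum>l<k. w l * Q (Suc k) x i l * Q (Suc k) x l j) =
          (\<Sum>l<k. w l * ?q i l * ?q l j - c * ?q k j * (w l * ?q i l * ?q l k) -
             c * ?q i k * (w l * ?q k l * ?q l j) + c\<^sup>2 * ?q i k * ?q k j * (w l * ?q k l * ?q l k))"
        unfolding Q' by (intro sum.cong refl) (simp add: algebra_simps power2_eq_square)
      also have "\<dots> = S i j w - c * ?q k j * S i k w - c * ?q i k * S k j w +
          c\<^sup>2 * ?q i k * ?q k j * S k k w"
        unfolding S_def sum_distrib_left by (simp only: sum.distrib sum_subtractf)
      finally show ?thesis .
    qed
    have D: "D i j p = - S i j (\<lambda>l. da l p) - d\<tau> p / \<tau> x * (?q i j - S i j (\<lambda>l. a l x))" for i j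
      by (simp add: D_def S_def)
    have ab: "a k x = c * b" "1 / b = 1 - c * ?q k k"
    proof -
      show "a k x = c * b" using b by (simp add: c_def)
      have "c * ?q k k = (b - 1) / b" by (simp add: c_def b_def)
      then show "1 / b = 1 - c * ?q k k" using b by (simp add: diff_divide_distrib)
    qed
    \<comment> \<open>The new summand l = k is treated apart: row and column k are the old ones
      divided by \<open>b\<close>.\<close>
    have S_Suc: "(\<Sum>l<Suc k. w l * Q (Suc k) x i l * Q (Suc k) x l j) =
        S i j w - c * ?q k j * S i k w - c * ?q i k * S k j w + c\<^sup>2 * ?q i k * ?q k j * S k k w +
        w k * (?q i k / b) * (?q k j / b)" for w
      unfolding sum.lessThan_Suc S Qk ..
    show "- (\<Sum>l<Suc k. da l p * Q (Suc k) x i l * Q (Suc k) x l j) -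
       d\<tau> p / \<tau> x * (Q (Suc k) x i j - (\<Sum>l<Suc k. a l x * Q (Suc k) x i l * Q (Suc k) x l j)) =
       D i j p - (((da k p * ?q i k + a k x * D i k p) * ?q k j + a k x * ?q i k * D k j p) / b -
         a k x * ?q i k * ?q k j * (0 + (da k p * ?q k k + a k x * D k k p)) / b\<^sup>2)"
      unfolding S_Suc unfolding Q' D
      by (rule sweep_derivative_step[OF b ab])
  qed
qed

lemma has_slopes_ln_Re:
  assumes "has_slopes m F dF x" "Im (F x) = 0" "0 < Re (F x)"
  shows "has_slopes m (\<lambda>v. ln (Re (F v))) (\<lambda>p. Re (dF p / F x)) x"
proof (rule has_slopes_eq)
  show "has_slopes m (\<lambda>v. ln (Re (F v))) (\<lambda>p. 1 / Re (F x) * Re (dF p)) x"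
    by (rule has_slopes_DERIV[OF has_slopes_Re[OF assms(1)]]) (use assms(3) in \<open>auto intro!: derivative_eq_intros\<close>)
  have "F x = of_real (Re (F x))" using assms(2) by (simp add: complex_eq_iff)
  then show "Re (dF p / F x) = 1 / Re (F x) * Re (dF p)" for p
    by (metis Re_divide_of_real mult.commute times_divide_eq_right mult_1)
qed

text \<open>The gradient is tr (K_k^{-1} dK_k), with tau tr K_k^{-1} expressed as n - sum_l a_l
  Q_ll. The logarithms involve the pivots of all earlier stages, yet the derivative involves only
  the current Q; this is what makes it cheap.\<close>

lemma has_slopes_logdet:
  fixes G :: "nat \<Rightarrow> nat \<Rightarrow> complex" and \<tau> :: "(nat \<Rightarrow> real) \<Rightarrow> complex"
    and a :: "nat \<Rightarrow> (nat \<Rightarrow> real) \<Rightarrow> complex"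
  defines "Q \<equiv> \<lambda>k v. sweep (\<lambda>i j. G i j / \<tau> v) (\<lambda>l. a l v) k"
  assumes \<tau>: "has_slopes m \<tau> d\<tau> x" "Im (\<tau> x) = 0" "0 < Re (\<tau> x)"
    and a: "\<And>k. k < s \<Longrightarrow> has_slopes m (a k) (da k) x"
    and pos: "\<And>k. k < s \<Longrightarrow> Im (1 + a k x * Q k x k k) = 0"
      "\<And>k. k < s \<Longrightarrow> 0 < Re (1 + a k x * Q k x k k)"
    and "k \<le> s"
  shows "has_slopes m (\<lambda>v. of_nat n * ln (Re (\<tau> v)) + (\<Sum>l<k. ln (Re (1 + a l v * Q l v l l))))
    (\<lambda>p. Re ((\<Sum>l<k. da l p * Q k x l l) + d\<tau> p / \<tau> x * (of_nat n - (\<Sum>l<k. a l x * Q k x l l)))) x"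
  using \<open>k \<le> s\<close>
proof (induction k)
  case 0
  have *: "has_slopes m (\<lambda>v. of_nat n * ln (Re (\<tau> v))) (\<lambda>p. of_nat n * Re (d\<tau> p / \<tau> x)) x"
    by (intro has_slopes_cmult has_slopes_ln_Re \<tau>)
  have "Re (z * of_nat n) = of_nat n * Re z" for z
    by (simp only: times_complex.sel complex_Re_of_nat complex_Im_of_nat) simp
  then have "has_slopes m (\<lambda>v. of_nat n * ln (Re (\<tau> v))) (\<lambda>p. Re (d\<tau> p / \<tau> x * of_nat n)) x"
    by (intro has_slopes_eq[OF *])
  then show ?case by (simp only: lessThan_0 sum.empty add_0 add_0_right diff_zero)
next
  case (Suc k)
  then have k: "k < s" by simp
  let ?q = "Q k x"
  have nz: "1 + a k x * Q k x k k \<noteq> 0" if "k < s" for k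
    using pos(2)[OF that] by force
  have \<tau>nz: "\<tau> x \<noteq> 0" using \<tau>(3) by force
  define b where "b = 1 + a k x * ?q k k"
  have b: "b \<noteq> 0" using nz[OF k] by (simp add: b_def)
  define c where "c = a k x / b"
  have Q': "Q (Suc k) x i j = ?q i j - c * ?q i k * ?q k j" for i j
    by (simp add: Q_def c_def b_def)
  have Qk: "Q (Suc k) x k k = ?q k k / b"
    using sweep_Suc_index[of "\<lambda>l. a l x" k "\<lambda>i j. G i j / \<tau> x"] nz[OF k] by (simp_all add: Q_def b_def)
  define D where "D p = - (\<Sum>l<k. da l p * ?q k l * ?q l k) -
       d\<tau> p / \<tau> x * (?q k k - (\<Sum>l<k. a l x * ?q k l * ?q l k))" for p
  have "has_slopes m (\<lambda>v. Q k v k k) D x"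
    unfolding D_def using has_slopes_sweep[of m \<tau> d\<tau> x s a da G k k k] \<tau>(1) \<tau>nz a nz k
    unfolding Q_def by simp
  then have "has_slopes m (\<lambda>v. 1 + a k v * Q k v k k) (\<lambda>p. 0 + (da k p * ?q k k + a k x * D p)) x"
    by (intro has_slopes_add has_slopes_const has_slopes_mult a k)
  from has_slopes_ln_Re[OF this pos(1)[OF k] pos(2)[OF k]]
  have "has_slopes m (\<lambda>v. ln (Re (1 + a k v * Q k v k k)))
      (\<lambda>p. Re ((0 + (da k p * ?q k k + a k x * D p)) / b)) x"
    by (simp only: b_def)
  from has_slopes_add[OF Suc.IH this] k
  have "has_slopes m (\<lambda>v. of_nat n * ln (Re (\<tau> v)) + (\<Sum>l<Suc k. ln (Re (1 + a l v * Q l v l l))))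
    (\<lambda>p. Re ((\<Sum>l<k. da l p * ?q l l) + d\<tau> p / \<tau> x * (of_nat n - (\<Sum>l<k. a l x * ?q l l))) +
       Re ((0 + (da k p * ?q k k + a k x * D p)) / b)) x"
    by (simp add: add.assoc)
  then show ?case
  proof (rule has_slopes_eq)
    fix p
    \<comment> \<open>An update lowers these trace sums by c times the very sums that occur in the
      derivative \<open>D\<close> of Q_kk; the two contributions cancel.\<close>
    have S: "(\<Sum>l<k. w l * Q (Suc k) x l l) =
        (\<Sum>l<k. w l * ?q l l) - c * (\<Sum>l<k. w l * ?q k l * ?q l k)" for w
    proof -
      have "(\<Sum>l<k. w l * Q (Suc k) x l l) = (\<Sum>l<k. w l * ?q l l - c * (w l * ?q k l * ?q l k))"
        unfolding Q' by (intro sum.cong refl) (simp add: algebra_simps)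
      then show ?thesis by (simp only: sum_distrib_left sum_subtractf)
    qed
    have quot: "(0 + (da k p * ?q k k + a k x * D p)) / b = da k p * (?q k k / b) + c * D p"
      "a k x * (?q k k / b) = c * ?q k k"
      by (simp_all add: c_def add_divide_distrib)
    have "(\<Sum>l<Suc k. da l p * Q (Suc k) x l l) + d\<tau> p / \<tau> x * (of_nat n - (\<Sum>l<Suc k. a l x * Q (Suc k) x l l)) =
      (\<Sum>l<k. da l p * ?q l l) + d\<tau> p / \<tau> x * (of_nat n - (\<Sum>l<k. a l x * ?q l l)) +
       (0 + (da k p * ?q k k + a k x * D p)) / b"
      unfolding sum.lessThan_Suc S Qk quot unfolding D_def by (simp add: algebra_simps)
    then show "Re ((\<Sum>l<Suc k. da l p * Q (Suc k) x l l) +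
        d\<tau> p / \<tau> x * (of_nat n - (\<Sum>l<Suc k. a l x * Q (Suc k) x l l))) =
      Re ((\<Sum>l<k. da l p * ?q l l) + d\<tau> p / \<tau> x * (of_nat n - (\<Sum>l<k. a l x * ?q l l))) +
       Re ((0 + (da k p * ?q k k + a k x * D p)) / b)"
      by (simp only: plus_complex.sel)
  qed
qed

section \<open>Reasoning about programs\<close>

text \<open>Cost and footprint can be computed from the counters and sizes alone, since stored
  numbers influence neither indices nor control flow. Resource bounds are thereby separated from
  correctness.\<close>

primrec cost :: "gl_model \<Rightarrow> com \<Rightarrow> (nat \<Rightarrow> nat) \<Rightarrow> nat" where
  "cost M (Assign a i j e) \<rho> = ccost e + 1"
| "cost M (Emit e) \<rho> = ccost e + 1"
| "cost M Next \<rho> = 1"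
| "cost M (Seq c c') \<rho> = cost M c \<rho> + cost M c' \<rho>"
| "cost M (For v a b c) \<rho> = 1 + (\<Sum>k\<in>{ieval M \<rho> a..<ieval M \<rho> b}. 1 + cost M c (\<rho>(v := k)))"

primrec footprint :: "gl_model \<Rightarrow> com \<Rightarrow> (nat \<Rightarrow> nat) \<Rightarrow> (nat \<times> nat \<times> nat) set" where
  "footprint M (Assign a i j e) \<rho> = creads M \<rho> e \<union> {(a, ieval M \<rho> i, ieval M \<rho> j)}"
| "footprint M (Emit e) \<rho> = creads M \<rho> e"
| "footprint M Next \<rho> = {}"
| "footprint M (Seq c c') \<rho> = footprint M c \<rho> \<union> footprint M c' \<rho>"
| "footprint M (For v a b c) \<rho> = (\<Union>k\<in>{ieval M \<rho> a..<ieval M \<rho> b}. footprint M c (\<rho>(v := k)))"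

lemma steps_exec: "steps (exec M \<theta> c \<rho> \<sigma>) = steps \<sigma> + cost M c \<rho>"
proof (induction c arbitrary: \<rho> \<sigma>)
  case (For v a b c)
  have "steps (fold (\<lambda>k \<tau>. exec M \<theta> c (r k) (\<tau>\<lparr>steps := steps \<tau> + 1\<rparr>)) ks \<tau>) =
      steps \<tau> + (\<Sum>k\<leftarrow>ks. 1 + cost M c (r k))" for r :: "nat \<Rightarrow> nat \<Rightarrow> nat" and ks \<tau>
    by (induction ks arbitrary: \<tau>) (simp_all add: For.IH)
  from this[of "\<lambda>k. \<rho>(v := k)" "[ieval M \<rho> a..<ieval M \<rho> b]"] show ?case
    unfolding exec.simps cost.simps interv_sum_list_conv_sum_set_nat by simp
qed (simp_all add: Let_def)

lemma touched_exec: "touched (exec M \<theta> c \<rho> \<sigma>) = touched \<sigma> \<union> footprint M c \<rho>"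
proof (induction c arbitrary: \<rho> \<sigma>)
  case (For v a b c)
  have "touched (fold (\<lambda>k \<tau>. exec M \<theta> c (r k) (\<tau>\<lparr>steps := steps \<tau> + 1\<rparr>)) ks \<tau>) =
      touched \<tau> \<union> (\<Union>k\<in>set ks. footprint M c (r k))" for r :: "nat \<Rightarrow> nat \<Rightarrow> nat" and ks \<tau>
    by (induction ks arbitrary: \<tau>) (simp_all add: For.IH Un_assoc)
  from this[of "\<lambda>k. \<rho>(v := k)"] show ?case
    unfolding exec.simps footprint.simps set_upt by simp
qed (simp_all add: Let_def Un_assoc Un_ac)

type_synonym assertion = "(nat \<Rightarrow> nat \<Rightarrow> nat \<Rightarrow> complex) \<Rightarrow> nat \<Rightarrow> complex list \<Rightarrow> bool"

text \<open>Expressions look at \<open>store\<close> and \<open>pos\<close> only; the other fields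
  are filled with dummy values.\<close>

abbreviation view :: "(nat \<Rightarrow> nat \<Rightarrow> nat \<Rightarrow> complex) \<Rightarrow> nat \<Rightarrow> machine" where
  "view s p \<equiv> \<lparr>store = s, touched = {}, pos = p, out = [], steps = 0\<rparr>"

text \<open>Assertions do not see \<open>steps\<close> and \<open>touched\<close>, which
  \<open>cost\<close> and \<open>footprint\<close> account for. Every program terminates, so partial
  and total correctness coincide.\<close>

definition triple ::
    "gl_model \<Rightarrow> (nat \<Rightarrow> real) \<Rightarrow> (nat \<Rightarrow> nat) \<Rightarrow> assertion \<Rightarrow> com \<Rightarrow> assertion \<Rightarrow> bool" where
  "triple M \<theta> \<rho> P c Q \<longleftrightarrow> (\<forall>\<sigma>. P (store \<sigma>) (pos \<sigma>) (out \<sigma>) \<longrightarrow>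
     (let \<sigma>' = exec M \<theta> c \<rho> \<sigma> in Q (store \<sigma>') (pos \<sigma>') (out \<sigma>')))"

lemma ceval_view: "ceval M \<theta> \<rho> \<sigma> e = ceval M \<theta> \<rho> (view (store \<sigma>) (pos \<sigma>)) e"
  by (induction e) simp_all

lemma triple_Assign:
  assumes "\<And>s p w. P s p w \<Longrightarrow> Q (s(a := (s a)(ieval M \<rho> i := (s a (ieval M \<rho> i))
    (ieval M \<rho> j := ceval M \<theta> \<rho> (view s p) e)))) p w"
  shows "triple M \<theta> \<rho> P (Assign a i j e) Q"
  unfolding triple_def
proof (intro allI impI)
  fix \<sigma> :: machine assume "P (store \<sigma>) (pos \<sigma>) (out \<sigma>)"
  from assms[OF this] show "let \<sigma>' = exec M \<theta> (Assign a i j e) \<rho> \<sigma> in Q (store \<sigma>') (pos \<sigma>') (out \<sigma>')"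
    by (simp add: Let_def ceval_view[of _ _ _ \<sigma>])
qed

lemma triple_Emit:
  assumes "\<And>s p w. P s p w \<Longrightarrow> Q s p (w @ [ceval M \<theta> \<rho> (view s p) e])"
  shows "triple M \<theta> \<rho> P (Emit e) Q"
  unfolding triple_def
proof (intro allI impI)
  fix \<sigma> :: machine assume "P (store \<sigma>) (pos \<sigma>) (out \<sigma>)"
  from assms[OF this] show "let \<sigma>' = exec M \<theta> (Emit e) \<rho> \<sigma> in Q (store \<sigma>') (pos \<sigma>') (out \<sigma>')"
    by (simp add: Let_def ceval_view[of _ _ _ \<sigma>])
qed

lemma triple_Next:
  assumes "\<And>s p w. P s p w \<Longrightarrow> Q s (p + 1) w"
  shows "triple M \<theta> \<rho> P Next Q"
  using assms by (auto simp: triple_def Let_def)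

lemma triple_Seq:
  assumes "triple M \<theta> \<rho> P c R" "triple M \<theta> \<rho> R c' Q"
  shows "triple M \<theta> \<rho> P (Seq c c') Q"
  using assms by (simp add: triple_def Let_def)

lemma triple_conseq:
  assumes "triple M \<theta> \<rho> P' c Q'" "\<And>s p w. P s p w \<Longrightarrow> P' s p w" "\<And>s p w. Q' s p w \<Longrightarrow> Q s p w"
  shows "triple M \<theta> \<rho> P c Q"
  using assms by (simp add: triple_def Let_def)

lemma triple_For:
  assumes "\<And>k. ieval M \<rho> a \<le> k \<Longrightarrow> k < ieval M \<rho> b \<Longrightarrow> triple M \<theta> (\<rho>(v := k)) (I k) c (I (Suc k))"
    and "ieval M \<rho> a \<le> ieval M \<rho> b"
  shows "triple M \<theta> \<rho> (I (ieval M \<rho> a)) (For v a b c) (I (ieval M \<rho> b))"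
proof -
  define f where "f k \<tau> = exec M \<theta> c (\<rho>(v := k)) (\<tau>\<lparr>steps := steps \<tau> + 1\<rparr>)" for k \<tau>
  have f: "I (Suc k) (store (f k \<tau>)) (pos (f k \<tau>)) (out (f k \<tau>))"
    if "ieval M \<rho> a \<le> k" "k < ieval M \<rho> b" "I k (store \<tau>) (pos \<tau>) (out \<tau>)" for k \<tau>
    using assms(1)[OF that(1,2)] that(3) unfolding triple_def Let_def f_def by simp
  have "I n (store (fold f [ieval M \<rho> a..<n] \<sigma>)) (pos (fold f [ieval M \<rho> a..<n] \<sigma>))
      (out (fold f [ieval M \<rho> a..<n] \<sigma>))"
    if "ieval M \<rho> a \<le> n" "n \<le> ieval M \<rho> b" "I (ieval M \<rho> a) (store \<sigma>) (pos \<sigma>) (out \<sigma>)" for n \<sigma>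
    using that
  proof (induction n rule: dec_induct)
    case (step n)
    then show ?case by (simp add: f)
  qed simp
  then show ?thesis
    using assms(2) unfolding triple_def Let_def exec.simps f_def[abs_def] by simp
qed

text \<open>Counters 1 and 2 belong to this loop nest; the loops placed around it count with 0 or 3,
  which \<open>e\<close> can therefore still refer to.\<close>

definition fill :: "nat \<Rightarrow> iexp \<Rightarrow> iexp \<Rightarrow> iexp \<Rightarrow> iexp \<Rightarrow> cexp \<Rightarrow> com" where
  "fill A a b c d e = For 1 a b (For 2 c d (Assign A (IVar 1) (IVar 2) e))"

definition set_block ::
    "(nat \<Rightarrow> nat \<Rightarrow> nat \<Rightarrow> complex) \<Rightarrow> nat \<Rightarrow> nat \<Rightarrow> nat \<Rightarrow> nat \<Rightarrow> nat \<Rightarrow>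
     (nat \<Rightarrow> nat \<Rightarrow> complex) \<Rightarrow> nat \<Rightarrow> nat \<Rightarrow> nat \<Rightarrow> complex" where
  "set_block s A a b c d E = s(A := (\<lambda>i j.
     if a \<le> i \<and> i < b \<and> c \<le> j \<and> j < d then E i j else s A i j))"

text \<open>
  The value written to a cell may depend on the old content of that cell and of cells outside
  the block, but not on other cells of the block.
\<close>

lemma triple_fill:
  assumes "ieval M \<rho> a = na" "ieval M \<rho> b = nb"
    and "\<And>k. ieval M (\<rho>(1 := k)) c = nc" "\<And>k. ieval M (\<rho>(1 := k)) d = nd"
    and "na \<le> nb" "nc \<le> nd"
    and E: "\<And>s p w i j s'. P s p w \<Longrightarrow> na \<le> i \<Longrightarrow> i < nb \<Longrightarrow> nc \<le> j \<Longrightarrow> j < nd \<Longrightarrow>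
      (\<And>B. B \<noteq> A \<Longrightarrow> s' B = s B) \<Longrightarrow> s' A i j = s A i j \<Longrightarrow>
      (\<And>i j. \<not> (na \<le> i \<and> i < nb \<and> nc \<le> j \<and> j < nd) \<Longrightarrow> s' A i j = s A i j) \<Longrightarrow>
      ceval M \<theta> (\<rho>(1 := i, 2 := j)) (view s' p) e = E s p i j"
    and Q: "\<And>s p w. P s p w \<Longrightarrow> Q (set_block s A na nb nc nd (E s p)) p w"
  shows "triple M \<theta> \<rho> P (fill A a b c d e) Q"
proof -
  \<comment> \<open>The invariant compares with the state \<open>s0\<close>, \<open>p0\<close>,
    \<open>w0\<close> before the loops: the rows below k and the entries of row k below l have been
    written, with values computed from that initial state.\<close>
  define I where "I s0 p0 w0 k l = (\<lambda>s p w. P s0 p0 w0 \<and> p = p0 \<and> w = w0 \<and>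
    s = s0(A := (\<lambda>i j. if na \<le> i \<and> (i < k \<or> i = k \<and> j < l) \<and> i < nb \<and> nc \<le> j \<and> j < nd then E s0 p0 i j
      else s0 A i j)))" for s0 p0 w0 k l
  have body: "triple M \<theta> (\<rho>(1 := k, 2 := l)) (I s0 p0 w0 k l) (Assign A (IVar 1) (IVar 2) e)
      (I s0 p0 w0 k (Suc l))" if "na \<le> k" "k < nb" "nc \<le> l" "l < nd" for s0 p0 w0 k l
  proof (rule triple_Assign)
    fix s p w assume I: "I s0 p0 w0 k l s p w"
    then have "ceval M \<theta> (\<rho>(1 := k, 2 := l)) (view s p) e = E s0 p0 k l"
      using that unfolding I_def
      by (elim conjE, simp only:, intro E[of s0 p0 w0]) auto
    with I that show "I s0 p0 w0 k (Suc l) (s(A := (s A)(ieval M (\<rho>(1 := k, 2 := l)) (IVar 1) :=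
        (s A (ieval M (\<rho>(1 := k, 2 := l)) (IVar 1)))(ieval M (\<rho>(1 := k, 2 := l)) (IVar 2) :=
          ceval M \<theta> (\<rho>(1 := k, 2 := l)) (view s p) e)))) p w"
      by (auto simp: I_def fun_eq_iff less_Suc_eq)
  qed
  have row: "triple M \<theta> (\<rho>(1 := k)) (I s0 p0 w0 k nc) (For 2 c d (Assign A (IVar 1) (IVar 2) e))
      (I s0 p0 w0 (Suc k) nc)" if "na \<le> k" "k < nb" for s0 p0 w0 k
  proof -
    have "triple M \<theta> (\<rho>(1 := k)) (I s0 p0 w0 k (ieval M (\<rho>(1 := k)) c))
        (For 2 c d (Assign A (IVar 1) (IVar 2) e)) (I s0 p0 w0 k (ieval M (\<rho>(1 := k)) d))"
      unfolding assms(3,4) by (rule triple_For[of M "\<rho>(1 := k)" c d \<theta> 2 "I s0 p0 w0 k", unfolded assms(3,4)])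
        (use body that assms(6) in blast)+
    then show ?thesis
      by (rule triple_conseq) (use assms(3,4) in \<open>auto simp: I_def fun_eq_iff less_Suc_eq\<close>)
  qed
  have all: "triple M \<theta> \<rho> (I s0 p0 w0 (ieval M \<rho> a) nc) (fill A a b c d e) (I s0 p0 w0 (ieval M \<rho> b) nc)"
    for s0 p0 w0
    unfolding fill_def assms(1,2)
    by (rule triple_For[of M \<rho> a b \<theta> 1 "\<lambda>k. I s0 p0 w0 k nc", unfolded assms(1,2)])
      (use row assms(5) in blast)+
  show ?thesis
    unfolding triple_def
  proof (intro allI impI)
    fix \<sigma> :: machine assume P: "P (store \<sigma>) (pos \<sigma>) (out \<sigma>)"
    then have "I (store \<sigma>) (pos \<sigma>) (out \<sigma>) (ieval M \<rho> a) nc (store \<sigma>) (pos \<sigma>) (out \<sigma>)"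
      by (auto simp: I_def assms(1) fun_eq_iff)
    then have *: "let \<sigma>' = exec M \<theta> (fill A a b c d e) \<rho> \<sigma> in
        I (store \<sigma>) (pos \<sigma>) (out \<sigma>) nb nc (store \<sigma>') (pos \<sigma>') (out \<sigma>')"
      using all[of "store \<sigma>" "pos \<sigma>" "out \<sigma>"] unfolding triple_def assms(2) by blast
    have "I (store \<sigma>) (pos \<sigma>) (out \<sigma>) nb nc s p w \<Longrightarrow>
        s = set_block (store \<sigma>) A na nb nc nd (E (store \<sigma>) (pos \<sigma>)) \<and> p = pos \<sigma> \<and> w = out \<sigma>" for s p w
      by (auto simp: I_def set_block_def fun_eq_iff)
    with * Q[OF P] show "let \<sigma>' = exec M \<theta> (fill A a b c d e) \<rho> \<sigma> in Q (store \<sigma>') (pos \<sigma>') (out \<sigma>')"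
      unfolding Let_def by metis
  qed
qed

text \<open>Evaluating \<open>e\<close> with an arbitrary \<open>x\<close> in the accumulator cell
  expresses that the summands do not depend on the running sum.\<close>

lemma triple_accumulate:
  assumes "ieval M \<rho> a = 0" "ieval M \<rho> b = n"
    and ij: "\<And>k. ieval M (\<rho>(v := k)) i = i'" "\<And>k. ieval M (\<rho>(v := k)) j = j'"
    and E: "\<And>s p w k x. P s p w \<Longrightarrow> k < n \<Longrightarrow>
      ceval M \<theta> (\<rho>(v := k)) (view (s(A := (s A)(i' := (s A i')(j' := x)))) p) e = E s p k"
    and Q: "\<And>s p w. P s p w \<Longrightarrow>
      Q (s(A := (s A)(i' := (s A i')(j' := s A i' j' + (\<Sum>k<n. E s p k))))) p w"
  shows "triple M \<theta> \<rho> P (For v a b (Assign A i j (Add (Cell A i j) e))) Q"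
proof -
  define I where "I s0 p0 w0 k = (\<lambda>s p w. P s0 p0 w0 \<and> p = p0 \<and> w = w0 \<and>
    s = s0(A := (s0 A)(i' := (s0 A i')(j' := s0 A i' j' + (\<Sum>k<k. E s0 p0 k)))))" for s0 p0 w0 k
  have "triple M \<theta> (\<rho>(v := k)) (I s0 p0 w0 k) (Assign A i j (Add (Cell A i j) e)) (I s0 p0 w0 (Suc k))"
    if "k < n" for s0 p0 w0 k
  proof (rule triple_Assign)
    fix s p w assume "I s0 p0 w0 k s p w"
    with E[OF _ that, of s0 p0 w0]
    show "I s0 p0 w0 (Suc k) (s(A := (s A)(ieval M (\<rho>(v := k)) i := (s A (ieval M (\<rho>(v := k)) i))
        (ieval M (\<rho>(v := k)) j := ceval M \<theta> (\<rho>(v := k)) (view s p) (Add (Cell A i j) e))))) p w"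
      unfolding ij by (simp add: I_def ij add.assoc)
  qed
  then have all: "triple M \<theta> \<rho> (I s0 p0 w0 0) (For v a b (Assign A i j (Add (Cell A i j) e))) (I s0 p0 w0 n)"
    for s0 p0 w0
    by (intro triple_For[of M \<rho> a b \<theta> v "I s0 p0 w0", unfolded assms(1,2)]) auto
  show ?thesis
    unfolding triple_def
  proof (intro allI impI)
    fix \<sigma> :: machine assume P: "P (store \<sigma>) (pos \<sigma>) (out \<sigma>)"
    then have "I (store \<sigma>) (pos \<sigma>) (out \<sigma>) 0 (store \<sigma>) (pos \<sigma>) (out \<sigma>)"
      by (auto simp: I_def)
    with all[of "store \<sigma>" "pos \<sigma>" "out \<sigma>"] Q[OF P]
    show "let \<sigma>' = exec M \<theta> (For v a b (Assign A i j (Add (Cell A i j) e))) \<rho> \<sigma> in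
        Q (store \<sigma>') (pos \<sigma>') (out \<sigma>')"
      unfolding triple_def I_def Let_def by metis
  qed
qed

section \<open>The algorithms\<close>

text \<open>The Gram matrix is a sum over training points of s by s outer products, so one pass over
  the stream suffices and Z is never stored.\<close>

definition gram_prog :: com where
  "gram_prog =
    Seq (fill 0 (INum 0) SizeS (INum 0) SizeS (Num 0))
    (For 0 (INum 0) SizeN (Seq
      (fill 0 (INum 0) SizeS (INum 0) SizeS
        (Add (Cell 0 (IVar 1) (IVar 2)) (Mul (Cnj (Feat (IVar 1))) (Feat (IVar 2)))))
      Next))"

definition node_feature :: "gl_model \<Rightarrow> nat \<Rightarrow> nat \<Rightarrow> complex" where
  "node_feature M j l = feat M (xpt M l) (node M j)"

lemma gram_mat_index:
  assumes "j < nnodes M" "k < nnodes M"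
  shows "gram_mat M $$ (j, k) = cdot (npts M) (node_feature M j) (node_feature M k)"
proof -
  have "dim_row (mat_adjoint (feature_mat M)) = nnodes M"
    "dim_col (mat_adjoint (feature_mat M)) = npts M"
    by (simp_all add: mat_adjoint_def feature_mat_def)
  with assms show ?thesis
    by (simp add: gram_mat_def mat_adjoint_def feature_mat_def scalar_prod_def cdot_def node_feature_def
        lessThan_atLeast0 mat_of_rows_index)
qed

lemma triple_gram_prog:
  "triple M \<theta> \<rho> (\<lambda>s p w. p = 0) gram_prog
     (\<lambda>s p w. \<forall>i<nnodes M. \<forall>j<nnodes M. s 0 i j = cdot (npts M) (node_feature M i) (node_feature M j))"
  unfolding gram_prog_def
proof (rule triple_Seq)
  \<comment> \<open>The length argument of \<open>cdot\<close> is the number of training points read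
    so far.\<close>
  let ?I = "\<lambda>k s p w. p = k \<and>
    (\<forall>i<nnodes M. \<forall>j<nnodes M. s 0 i j = cdot k (node_feature M i) (node_feature M j))"
  show "triple M \<theta> \<rho> (\<lambda>s p w. p = 0) (fill 0 (INum 0) SizeS (INum 0) SizeS (Num 0)) (?I 0)"
    by (rule triple_fill[where na=0 and nb="nnodes M" and nc=0 and nd="nnodes M" and E="\<lambda>_ _ _ _. 0"])
      (simp_all add: set_block_def cdot_def)
  have "triple M \<theta> (\<rho>(0 := k)) (?I k) (Seq (fill 0 (INum 0) SizeS (INum 0) SizeS
        (Add (Cell 0 (IVar 1) (IVar 2)) (Mul (Cnj (Feat (IVar 1))) (Feat (IVar 2))))) Next) (?I (Suc k))" for k
  proof (rule triple_Seq[where R="\<lambda>s p w. p = k \<and>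
      (\<forall>i<nnodes M. \<forall>j<nnodes M. s 0 i j = cdot (Suc k) (node_feature M i) (node_feature M j))"])
    show "triple M \<theta> (\<rho>(0 := k)) (?I k) (fill 0 (INum 0) SizeS (INum 0) SizeS
        (Add (Cell 0 (IVar 1) (IVar 2)) (Mul (Cnj (Feat (IVar 1))) (Feat (IVar 2)))))
        (\<lambda>s p w. p = k \<and>
      (\<forall>i<nnodes M. \<forall>j<nnodes M. s 0 i j = cdot (Suc k) (node_feature M i) (node_feature M j)))"
      by (rule triple_fill[where na=0 and nb="nnodes M" and nc=0 and nd="nnodes M" and
          E="\<lambda>_ _ i j. cdot (Suc k) (node_feature M i) (node_feature M j)"])
        (simp_all add: set_block_def cdot_def node_feature_def)
  qed (rule triple_Next, simp)
  then have "triple M \<theta> \<rho> (?I (ieval M \<rho> (INum 0))) (For 0 (INum 0) SizeN (Seq (fill 0 (INum 0) SizeS (INum 0) SizeS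
        (Add (Cell 0 (IVar 1) (IVar 2)) (Mul (Cnj (Feat (IVar 1))) (Feat (IVar 2))))) Next)) (?I (ieval M \<rho> SizeN))"
    by (intro triple_For[where I="?I"]) auto
  then show "triple M \<theta> \<rho> (?I 0) (For 0 (INum 0) SizeN (Seq (fill 0 (INum 0) SizeS (INum 0) SizeS
        (Add (Cell 0 (IVar 1) (IVar 2)) (Mul (Cnj (Feat (IVar 1))) (Feat (IVar 2))))) Next))
     (\<lambda>s p w. \<forall>i<nnodes M. \<forall>j<nnodes M. s 0 i j = cdot (npts M) (node_feature M i) (node_feature M j))"
    by (rule triple_conseq) auto
qed

text \<open>
  Index \<open>nnodes M\<close> stands for the response vector, which is thus treated as one more column of
  the feature matrix.
\<close>

definition column :: "gl_model \<Rightarrow> nat \<Rightarrow> nat \<Rightarrow> complex" where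
  "column M j = (if j < nnodes M then node_feature M j else (\<lambda>l. of_real (resp M l)))"

definition amplitude :: "gl_model \<Rightarrow> nat \<Rightarrow> (nat \<Rightarrow> real) \<Rightarrow> complex" where
  "amplitude M k \<theta> = of_real (sigma_f2 M \<theta>) * (of_real (wgt M k) * of_real (dens M (theta0 M \<theta>) (node M k)))"

definition swept :: "gl_model \<Rightarrow> nat \<Rightarrow> (nat \<Rightarrow> real) \<Rightarrow> nat \<Rightarrow> nat \<Rightarrow> complex" where
  "swept M k \<theta> = sweep (\<lambda>i j. cdot (npts M) (column M i) (column M j) / of_real (sigma_n2 M \<theta>))
     (\<lambda>l. amplitude M l \<theta>) k"

text \<open>The logarithm of the determinant after k updates. The redundant
  \<open>Re (of_real ...)\<close> keeps the shape of \<open>has_slopes_logdet\<close>.\<close>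

definition logdet_partial :: "gl_model \<Rightarrow> nat \<Rightarrow> (nat \<Rightarrow> real) \<Rightarrow> real" where
  "logdet_partial M k \<theta> = of_nat (npts M) * ln (Re (of_real (sigma_n2 M \<theta>))) +
     (\<Sum>l<k. ln (Re (1 + amplitude M l \<theta> * swept M l \<theta> l l)))"

text \<open>The numbers H_l of the overview: twice the derivative of the log marginal likelihood
  with respect to the amplitude a_l.\<close>

definition curvature :: "gl_model \<Rightarrow> (nat \<Rightarrow> real) \<Rightarrow> nat \<Rightarrow> complex" where
  "curvature M \<theta> l = swept M (nnodes M) \<theta> (nnodes M) l * swept M (nnodes M) \<theta> l (nnodes M) -
     swept M (nnodes M) \<theta> l l"

definition amp_exp :: "iexp \<Rightarrow> cexp" where
  "amp_exp k = Mul SigF2 (Mul (Wgt k) (Dens k))"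

text \<open>Taking real parts before output spares a proof that the results are real.\<close>

definition re_exp :: "cexp \<Rightarrow> cexp" where
  "re_exp e = Div (Add e (Cnj e)) (Num 2)"

definition curv_exp :: "iexp \<Rightarrow> cexp" where
  "curv_exp l = Sub (Mul (Cell 1 SizeS l) (Cell 1 l SizeS)) (Cell 1 l l)"

text \<open>
  Array 0 holds the Gram matrix, 1 the matrix $Q$, 2 a copy of it that the update reads from, and
  row 0 of array 4 the vector $Z^* y$. The cells of row 0 of array 3 are $y^T y$, $n$, $\log\det K$
  and the sum accumulated for a gradient entry.
\<close>

definition stream_prog :: com where
  "stream_prog =
    Seq (fill 4 (INum 0) (INum 1) (INum 0) SizeS (Num 0))
    (Seq (Assign 3 (INum 0) (INum 0) (Num 0))
    (Seq (Assign 3 (INum 0) (INum 1) (Num 0))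
    (For 0 (INum 0) SizeN
      (Seq (fill 4 (INum 0) (INum 1) (INum 0) SizeS
        (Add (Cell 4 (IVar 1) (IVar 2)) (Mul (Cnj (Feat (IVar 2))) Resp)))
      (Seq (Assign 3 (INum 0) (INum 0) (Add (Cell 3 (INum 0) (INum 0)) (Mul Resp Resp)))
      (Seq (Assign 3 (INum 0) (INum 1) (Add (Cell 3 (INum 0) (INum 1)) (Num 1)))
      Next))))))"

text \<open>Stage 0, where K = tau I: Q is the Gram matrix bordered by y and divided by tau, and log
  det K is n log tau. The last row is obtained by conjugating the last column.\<close>

definition init_prog :: com where
  "init_prog =
    Seq (fill 1 (INum 0) SizeS (INum 0) SizeS (Div (Cell 0 (IVar 1) (IVar 2)) SigN2))
    (Seq (fill 1 (INum 0) SizeS SizeS (IAdd SizeS (INum 1)) (Div (Cell 4 (INum 0) (IVar 1)) SigN2))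
    (Seq (fill 1 SizeS (IAdd SizeS (INum 1)) (INum 0) SizeS (Div (Cnj (Cell 4 (INum 0) (IVar 2))) SigN2))
    (Seq (Assign 1 SizeS SizeS (Div (Cell 3 (INum 0) (INum 0)) SigN2))
    (Assign 3 (INum 0) (INum 2) (Mul (Cell 3 (INum 0) (INum 1)) (Log SigN2))))))"

text \<open>Without the copy, row k and column k would be overwritten while other entries still need
  their old values. The copy keeps the storage at O(s^2).\<close>

definition sweep_prog :: com where
  "sweep_prog =
    For 3 (INum 0) SizeS
      (Seq (fill 2 (INum 0) (IAdd SizeS (INum 1)) (INum 0) (IAdd SizeS (INum 1)) (Cell 1 (IVar 1) (IVar 2)))
      (Seq (Assign 3 (INum 0) (INum 2) (Add (Cell 3 (INum 0) (INum 2))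
        (Log (Add (Num 1) (Mul (amp_exp (IVar 3)) (Cell 2 (IVar 3) (IVar 3)))))))
      (fill 1 (INum 0) (IAdd SizeS (INum 1)) (INum 0) (IAdd SizeS (INum 1))
        (Sub (Cell 2 (IVar 1) (IVar 2))
          (Div (Mul (Mul (amp_exp (IVar 3)) (Cell 2 (IVar 1) (IVar 3))) (Cell 2 (IVar 3) (IVar 2)))
            (Add (Num 1) (Mul (amp_exp (IVar 3)) (Cell 2 (IVar 3) (IVar 3)))))))))"

definition value_prog :: com where
  "value_prog = Emit (Sub (Sub
      (Mul (Div (Num (- 1)) (Num 2)) (re_exp (Cell 1 SizeS SizeS)))
      (Mul (Div (Num 1) (Num 2)) (Cell 3 (INum 0) (INum 2))))
      (Mul (Div (Cell 3 (INum 0) (INum 1)) (Num 2)) (Log (Mul (Num 2) PiConst))))"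

definition sum_prog :: "cexp \<Rightarrow> com" where
  "sum_prog e = Seq (Assign 3 (INum 0) (INum 3) (Num 0))
    (For 1 (INum 0) SizeS (Assign 3 (INum 0) (INum 3)
      (Add (Cell 3 (INum 0) (INum 3)) (Mul e (curv_exp (IVar 1))))))"

text \<open>The last output, for sigma_n^2, reuses the sum that the output for sigma_f^2 has left in
  the accumulator cell.\<close>

definition gradient_prog :: com where
  "gradient_prog =
    Seq (For 0 (INum 0) SizeP
      (Seq (sum_prog (Mul SigF2 (Mul (Wgt (IVar 1)) (DDens (IVar 0) (IVar 1)))))
        (Emit (Div (re_exp (Cell 3 (INum 0) (INum 3))) (Num 2)))))
    (Seq (sum_prog (Mul (Wgt (IVar 1)) (Dens (IVar 1))))
    (Seq (Emit (Div (re_exp (Cell 3 (INum 0) (INum 3))) (Num 2)))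
    (Emit (Div (Div (re_exp (Sub (Sub (Cell 1 SizeS SizeS) (Cell 3 (INum 0) (INum 1)))
      (Mul SigF2 (Cell 3 (INum 0) (INum 3))))) SigN2) (Num 2)))))"

definition lml_prog :: com where
  "lml_prog = Seq stream_prog (Seq init_prog (Seq sweep_prog (Seq value_prog gradient_prog)))"

section \<open>Correctness of the main program\<close>

lemma triple_stream_prog:
  fixes M
  defines "n \<equiv> npts M" and "N \<equiv> nnodes M"
  shows "triple M \<theta> \<rho>
     (\<lambda>s p w. p = 0 \<and> w = [] \<and> (\<forall>i<N. \<forall>j<N. s 0 i j = cdot n (column M i) (column M j)))
     stream_prog
     (\<lambda>s p w. w = [] \<and> (\<forall>i<N. \<forall>j<N. s 0 i j = cdot n (column M i) (column M j)) \<and>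
       (\<forall>j<N. s 4 0 j = cdot n (column M j) (column M N)) \<and>
       s 3 0 0 = cdot n (column M N) (column M N) \<and> s 3 0 1 = of_nat n)"
proof -
  let ?G = "\<lambda>s. \<forall>i<N. \<forall>j<N. s 0 i j = cdot n (column M i) (column M j)"
  let ?b = "\<lambda>k s. \<forall>j<N. s 4 0 j = cdot k (column M j) (column M N)"
  let ?y = "\<lambda>k s. s 3 0 0 = cdot k (column M N) (column M N)"
  let ?I = "\<lambda>k s p w. p = k \<and> w = [] \<and> ?G s \<and> ?b k s \<and> ?y k s \<and> s 3 0 1 = of_nat k"
  have 1: "triple M \<theta> \<rho> (\<lambda>s p w. p = 0 \<and> w = [] \<and> ?G s)
      (fill 4 (INum 0) (INum 1) (INum 0) SizeS (Num 0)) (\<lambda>s p w. p = 0 \<and> w = [] \<and> ?G s \<and> ?b 0 s)"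
    by (rule triple_fill[where na=0 and nb=1 and nc=0 and nd=N and E="\<lambda>_ _ _ _. 0"])
      (simp_all add: set_block_def cdot_def N_def)
  have 2: "triple M \<theta> \<rho> (\<lambda>s p w. p = 0 \<and> w = [] \<and> ?G s \<and> ?b 0 s) (Assign 3 (INum 0) (INum 0) (Num 0))
      (\<lambda>s p w. p = 0 \<and> w = [] \<and> ?G s \<and> ?b 0 s \<and> ?y 0 s)"
    by (rule triple_Assign) (simp add: cdot_def)
  have 3: "triple M \<theta> \<rho> (\<lambda>s p w. p = 0 \<and> w = [] \<and> ?G s \<and> ?b 0 s \<and> ?y 0 s)
      (Assign 3 (INum 0) (INum 1) (Num 0)) (?I 0)"
    by (rule triple_Assign) simp
  have body: "triple M \<theta> (\<rho>(0 := k)) (?I k)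
      (Seq (fill 4 (INum 0) (INum 1) (INum 0) SizeS
        (Add (Cell 4 (IVar 1) (IVar 2)) (Mul (Cnj (Feat (IVar 2))) Resp)))
      (Seq (Assign 3 (INum 0) (INum 0) (Add (Cell 3 (INum 0) (INum 0)) (Mul Resp Resp)))
      (Seq (Assign 3 (INum 0) (INum 1) (Add (Cell 3 (INum 0) (INum 1)) (Num 1)))
      Next))) (?I (Suc k))" for k
  proof (intro triple_Seq)
    show "triple M \<theta> (\<rho>(0 := k)) (?I k) (fill 4 (INum 0) (INum 1) (INum 0) SizeS
        (Add (Cell 4 (IVar 1) (IVar 2)) (Mul (Cnj (Feat (IVar 2))) Resp)))
        (\<lambda>s p w. p = k \<and> w = [] \<and> ?G s \<and> ?b (Suc k) s \<and> ?y k s \<and> s 3 0 1 = of_nat k)"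
      by (rule triple_fill[where na=0 and nb=1 and nc=0 and nd=N and
          E="\<lambda>_ _ i j. cdot (Suc k) (column M j) (column M N)"])
        (simp_all add: set_block_def cdot_def N_def column_def node_feature_def)
    show "triple M \<theta> (\<rho>(0 := k))
        (\<lambda>s p w. p = k \<and> w = [] \<and> ?G s \<and> ?b (Suc k) s \<and> ?y k s \<and> s 3 0 1 = of_nat k)
        (Assign 3 (INum 0) (INum 0) (Add (Cell 3 (INum 0) (INum 0)) (Mul Resp Resp)))
        (\<lambda>s p w. p = k \<and> w = [] \<and> ?G s \<and> ?b (Suc k) s \<and> ?y (Suc k) s \<and> s 3 0 1 = of_nat k)"
      by (rule triple_Assign) (simp add: cdot_def N_def column_def)
    \<comment> \<open>Expressions cannot read a problem size as a number, so \<open>n\<close>, which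
      enters the likelihood and its derivative in sigma_n^2, is counted along the stream.\<close>
    show "triple M \<theta> (\<rho>(0 := k))
        (\<lambda>s p w. p = k \<and> w = [] \<and> ?G s \<and> ?b (Suc k) s \<and> ?y (Suc k) s \<and> s 3 0 1 = of_nat k)
        (Assign 3 (INum 0) (INum 1) (Add (Cell 3 (INum 0) (INum 1)) (Num 1)))
        (\<lambda>s p w. p = k \<and> w = [] \<and> ?G s \<and> ?b (Suc k) s \<and> ?y (Suc k) s \<and> s 3 0 1 = of_nat (Suc k))"
      by (rule triple_Assign) simp
  qed (rule triple_Next, simp)
  have 4: "triple M \<theta> \<rho> (?I 0) (For 0 (INum 0) SizeN
      (Seq (fill 4 (INum 0) (INum 1) (INum 0) SizeS
        (Add (Cell 4 (IVar 1) (IVar 2)) (Mul (Cnj (Feat (IVar 2))) Resp)))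
      (Seq (Assign 3 (INum 0) (INum 0) (Add (Cell 3 (INum 0) (INum 0)) (Mul Resp Resp)))
      (Seq (Assign 3 (INum 0) (INum 1) (Add (Cell 3 (INum 0) (INum 1)) (Num 1)))
      Next)))) (?I n)"
    using triple_For[of M \<rho> "INum 0" SizeN \<theta> 0 ?I] body unfolding n_def ieval.simps by blast
  show ?thesis
    unfolding stream_prog_def
    by (rule triple_conseq[OF triple_Seq[OF 1 triple_Seq[OF 2 triple_Seq[OF 3 4]]]]) auto
qed

lemma triple_init_prog:
  fixes M
  defines "n \<equiv> npts M" and "N \<equiv> nnodes M"
  shows "triple M \<theta> \<rho>
     (\<lambda>s p w. w = [] \<and> (\<forall>i<N. \<forall>j<N. s 0 i j = cdot n (column M i) (column M j)) \<and>
       (\<forall>j<N. s 4 0 j = cdot n (column M j) (column M N)) \<and>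
       s 3 0 0 = cdot n (column M N) (column M N) \<and> s 3 0 1 = of_nat n)
     init_prog
     (\<lambda>s p w. w = [] \<and> s 3 0 1 = of_nat n \<and> s 3 0 2 = of_real (logdet_partial M 0 \<theta>) \<and>
       (\<forall>i\<le>N. \<forall>j\<le>N. s 1 i j = swept M 0 \<theta> i j))"
proof -
  let ?A = "\<lambda>s w. w = [] \<and> (\<forall>j<N. s (4::nat) (0::nat) j = cdot n (column M j) (column M N)) \<and>
       s 3 0 0 = cdot n (column M N) (column M N) \<and> s 3 0 1 = of_nat n"
  let ?q = "\<lambda>i j. cdot n (column M i) (column M j) / of_real (sigma_n2 M \<theta>)"
  let ?P0 = "\<lambda>s (p::nat) w. w = [] \<and> (\<forall>i<N. \<forall>j<N. s 0 i j = cdot n (column M i) (column M j)) \<and>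
       (\<forall>j<N. s 4 0 j = cdot n (column M j) (column M N)) \<and>
       s 3 0 0 = cdot n (column M N) (column M N) \<and> s 3 0 1 = of_nat n"
  let ?P1 = "\<lambda>s p w. ?A s w \<and> (\<forall>i<N. \<forall>j<N. s (1::nat) i j = ?q i j)"
  let ?P2 = "\<lambda>s p w. ?P1 s p w \<and> (\<forall>i<N. s 1 i N = ?q i N)"
  let ?P3 = "\<lambda>s p w. ?P2 s p w \<and> (\<forall>j<N. s 1 N j = ?q N j)"
  let ?P4 = "\<lambda>s p w. ?P3 s p w \<and> s 1 N N = ?q N N"
  have 1: "triple M \<theta> \<rho> ?P0 (fill 1 (INum 0) SizeS (INum 0) SizeS (Div (Cell 0 (IVar 1) (IVar 2)) SigN2)) ?P1"
    by (rule triple_fill[where na=0 and nb=N and nc=0 and nd=N and E="\<lambda>_ _ i j. ?q i j"])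
      (simp_all add: set_block_def N_def)
  have 2: "triple M \<theta> \<rho> ?P1
      (fill 1 (INum 0) SizeS SizeS (IAdd SizeS (INum 1)) (Div (Cell 4 (INum 0) (IVar 1)) SigN2)) ?P2"
    by (rule triple_fill[where na=0 and nb=N and nc=N and nd="N + 1" and E="\<lambda>_ _ i j. ?q i N"])
      (simp_all add: set_block_def N_def)
  have 3: "triple M \<theta> \<rho> ?P2
      (fill 1 SizeS (IAdd SizeS (INum 1)) (INum 0) SizeS (Div (Cnj (Cell 4 (INum 0) (IVar 2))) SigN2)) ?P3"
    by (rule triple_fill[where na=N and nb="N + 1" and nc=0 and nd=N and E="\<lambda>_ _ i j. ?q N j"])
      (simp_all add: set_block_def N_def cnj_cdot)
  have 4: "triple M \<theta> \<rho> ?P3 (Assign 1 SizeS SizeS (Div (Cell 3 (INum 0) (INum 0)) SigN2)) ?P4"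
    by (rule triple_Assign) (simp add: N_def)
  have 5: "triple M \<theta> \<rho> ?P4 (Assign 3 (INum 0) (INum 2) (Mul (Cell 3 (INum 0) (INum 1)) (Log SigN2)))
     (\<lambda>s p w. w = [] \<and> s 3 0 1 = of_nat n \<and> s 3 0 2 = of_real (logdet_partial M 0 \<theta>) \<and>
       (\<forall>i\<le>N. \<forall>j\<le>N. s 1 i j = swept M 0 \<theta> i j))"
    by (rule triple_Assign) (auto simp: N_def n_def logdet_partial_def swept_def le_less)
  show ?thesis
    unfolding init_prog_def
    by (rule triple_Seq[OF 1 triple_Seq[OF 2 triple_Seq[OF 3 triple_Seq[OF 4 5]]]])
qed

lemma triple_sweep_prog:
  fixes M
  defines "n \<equiv> npts M" and "N \<equiv> nnodes M"
  defines "I \<equiv> \<lambda>\<theta> k s (p::nat) w. w = ([]::complex list) \<and> s (3::nat) (0::nat) (1::nat) = of_nat n \<and>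
       s 3 0 2 = of_real (logdet_partial M k \<theta>) \<and>
       (\<forall>i\<le>N. \<forall>j\<le>N. s 1 i j = swept M k \<theta> i j)"
  shows "triple M \<theta> \<rho> (I \<theta> 0) sweep_prog (I \<theta> N)"
proof -
  have body: "triple M \<theta> (\<rho>(3 := k)) (I \<theta> k)
      (Seq (fill 2 (INum 0) (IAdd SizeS (INum 1)) (INum 0) (IAdd SizeS (INum 1)) (Cell 1 (IVar 1) (IVar 2)))
      (Seq (Assign 3 (INum 0) (INum 2) (Add (Cell 3 (INum 0) (INum 2))
        (Log (Add (Num 1) (Mul (amp_exp (IVar 3)) (Cell 2 (IVar 3) (IVar 3)))))))
      (fill 1 (INum 0) (IAdd SizeS (INum 1)) (INum 0) (IAdd SizeS (INum 1))
        (Sub (Cell 2 (IVar 1) (IVar 2))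
          (Div (Mul (Mul (amp_exp (IVar 3)) (Cell 2 (IVar 1) (IVar 3))) (Cell 2 (IVar 3) (IVar 2)))
            (Add (Num 1) (Mul (amp_exp (IVar 3)) (Cell 2 (IVar 3) (IVar 3)))))))))
      (I \<theta> (Suc k))" if "k < N" for k
  proof (intro triple_Seq)
    let ?B = "\<lambda>s. \<forall>i\<le>N. \<forall>j\<le>N. s 2 i j = swept M k \<theta> i j"
    show "triple M \<theta> (\<rho>(3 := k)) (I \<theta> k)
        (fill 2 (INum 0) (IAdd SizeS (INum 1)) (INum 0) (IAdd SizeS (INum 1)) (Cell 1 (IVar 1) (IVar 2)))
        (\<lambda>s p w. I \<theta> k s p w \<and> ?B s)"
      by (rule triple_fill[where na=0 and nb="N + 1" and nc=0 and nd="N + 1" and E="\<lambda>_ _ i j. swept M k \<theta> i j"])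
        (simp_all add: set_block_def I_def N_def less_Suc_eq_le)
    show "triple M \<theta> (\<rho>(3 := k)) (\<lambda>s p w. I \<theta> k s p w \<and> ?B s)
        (Assign 3 (INum 0) (INum 2) (Add (Cell 3 (INum 0) (INum 2))
        (Log (Add (Num 1) (Mul (amp_exp (IVar 3)) (Cell 2 (IVar 3) (IVar 3)))))))
        (\<lambda>s p w. w = [] \<and> s 3 0 1 = of_nat n \<and> s 3 0 2 = of_real (logdet_partial M (Suc k) \<theta>) \<and> ?B s)"
      by (rule triple_Assign) (use that in \<open>simp add: I_def amp_exp_def amplitude_def logdet_partial_def
          del: times_complex.sel plus_complex.sel\<close>)
    show "triple M \<theta> (\<rho>(3 := k))
        (\<lambda>s p w. w = [] \<and> s 3 0 1 = of_nat n \<and> s 3 0 2 = of_real (logdet_partial M (Suc k) \<theta>) \<and> ?B s)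
        (fill 1 (INum 0) (IAdd SizeS (INum 1)) (INum 0) (IAdd SizeS (INum 1))
        (Sub (Cell 2 (IVar 1) (IVar 2))
          (Div (Mul (Mul (amp_exp (IVar 3)) (Cell 2 (IVar 1) (IVar 3))) (Cell 2 (IVar 3) (IVar 2)))
            (Add (Num 1) (Mul (amp_exp (IVar 3)) (Cell 2 (IVar 3) (IVar 3)))))))
        (I \<theta> (Suc k))"
      by (rule triple_fill[where na=0 and nb="N + 1" and nc=0 and nd="N + 1" and
          E="\<lambda>_ _ i j. swept M (Suc k) \<theta> i j"])
        (use that in \<open>simp_all add: set_block_def I_def N_def less_Suc_eq_le swept_def amp_exp_def amplitude_def\<close>)
  qed
  show ?thesis
    unfolding sweep_prog_def
    using triple_For[of M \<rho> "INum 0" SizeS \<theta> 3 "I \<theta>"] body unfolding N_def ieval.simps by blast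
qed

lemma ceval_re_exp: "ceval M \<theta> \<rho> \<sigma> (re_exp e) = of_real (Re (ceval M \<theta> \<rho> \<sigma> e))"
  by (simp add: re_exp_def complex_add_cnj)

definition lml_value :: "gl_model \<Rightarrow> (nat \<Rightarrow> real) \<Rightarrow> real" where
  "lml_value M \<theta> = - 1 / 2 * Re (swept M (nnodes M) \<theta> (nnodes M) (nnodes M)) -
     1 / 2 * logdet_partial M (nnodes M) \<theta> - real (npts M) / 2 * ln (2 * pi)"

definition lml_grad_theta0 :: "gl_model \<Rightarrow> (nat \<Rightarrow> real) \<Rightarrow> nat \<Rightarrow> real" where
  "lml_grad_theta0 M \<theta> i = Re (\<Sum>l<nnodes M. of_real (sigma_f2 M \<theta>) * (of_real (wgt M l) *
     of_real (partial_deriv (\<lambda>t. dens M t (node M l)) i (theta0 M \<theta>))) * curvature M \<theta> l) / 2"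

text \<open>The sum of h_l H_l, twice the derivative in sigma_f^2. Multiplied by sigma_f^2 it is the
  sum of a_l H_l in the derivative with respect to sigma_n^2.\<close>

definition weighted_curvature :: "gl_model \<Rightarrow> (nat \<Rightarrow> real) \<Rightarrow> complex" where
  "weighted_curvature M \<theta> = (\<Sum>l<nnodes M. of_real (wgt M l) *
     of_real (dens M (theta0 M \<theta>) (node M l)) * curvature M \<theta> l)"

definition lml_grad_sigma_n2 :: "gl_model \<Rightarrow> (nat \<Rightarrow> real) \<Rightarrow> real" where
  "lml_grad_sigma_n2 M \<theta> = Re (swept M (nnodes M) \<theta> (nnodes M) (nnodes M) - of_nat (npts M) -
     of_real (sigma_f2 M \<theta>) * weighted_curvature M \<theta>) / sigma_n2 M \<theta> / 2"

definition lml_grad :: "gl_model \<Rightarrow> (nat \<Rightarrow> real) \<Rightarrow> nat \<Rightarrow> real" where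
  "lml_grad M \<theta> i = (if i < pdim M then lml_grad_theta0 M \<theta> i
     else if i = pdim M then Re (weighted_curvature M \<theta>) / 2 else lml_grad_sigma_n2 M \<theta>)"

lemma triple_sum_prog:
  fixes M
  defines "N \<equiv> nnodes M"
  assumes e: "\<And>s p k. k < N \<Longrightarrow> ceval M \<theta> (\<rho>(1 := k)) (view s p) e = E k"
  shows "triple M \<theta> \<rho>
     (\<lambda>s p w. w = w0 \<and> s 3 0 1 = c \<and> (\<forall>i\<le>N. \<forall>j\<le>N. s 1 i j = swept M N \<theta> i j))
     (sum_prog e)
     (\<lambda>s p w. w = w0 \<and> s 3 0 1 = c \<and> (\<forall>i\<le>N. \<forall>j\<le>N. s 1 i j = swept M N \<theta> i j) \<and>
        s 3 0 3 = (\<Sum>k<N. E k * curvature M \<theta> k))"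
  unfolding sum_prog_def
proof (rule triple_Seq)
  show "triple M \<theta> \<rho>
     (\<lambda>s p w. w = w0 \<and> s 3 0 1 = c \<and> (\<forall>i\<le>N. \<forall>j\<le>N. s 1 i j = swept M N \<theta> i j))
     (Assign 3 (INum 0) (INum 3) (Num 0))
     (\<lambda>s p w. w = w0 \<and> s 3 0 1 = c \<and> (\<forall>i\<le>N. \<forall>j\<le>N. s 1 i j = swept M N \<theta> i j) \<and> s 3 0 3 = 0)"
    by (rule triple_Assign) simp
  show "triple M \<theta> \<rho>
     (\<lambda>s p w. w = w0 \<and> s 3 0 1 = c \<and> (\<forall>i\<le>N. \<forall>j\<le>N. s 1 i j = swept M N \<theta> i j) \<and> s 3 0 3 = 0)
     (For 1 (INum 0) SizeS (Assign 3 (INum 0) (INum 3)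
      (Add (Cell 3 (INum 0) (INum 3)) (Mul e (curv_exp (IVar 1))))))
     (\<lambda>s p w. w = w0 \<and> s 3 0 1 = c \<and> (\<forall>i\<le>N. \<forall>j\<le>N. s 1 i j = swept M N \<theta> i j) \<and>
        s 3 0 3 = (\<Sum>k<N. E k * curvature M \<theta> k))"
  proof (rule triple_accumulate[where n=N and i'=0 and j'=3 and E="\<lambda>_ _ k. E k * curvature M \<theta> k"])
    fix s :: "nat \<Rightarrow> nat \<Rightarrow> nat \<Rightarrow> complex" and p :: nat and w k x
    assume "w = w0 \<and> s 3 0 1 = c \<and> (\<forall>i\<le>N. \<forall>j\<le>N. s 1 i j = swept M N \<theta> i j) \<and> s 3 0 3 = 0" "k < N"
    then show "ceval M \<theta> (\<rho>(1 := k)) (view (s(3 := (s 3)(0 := (s 3 0)(3 := x)))) p) (Mul e (curv_exp (IVar 1))) =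
        E k * curvature M \<theta> k"
      using e[of k] by (simp add: curv_exp_def curvature_def N_def)
  qed (simp_all add: N_def)
qed

lemma triple_value_prog:
  fixes M
  defines "N \<equiv> nnodes M" and "n \<equiv> npts M"
  shows "triple M \<theta> \<rho>
     (\<lambda>s p w. w = [] \<and> s 3 0 1 = of_nat n \<and> s 3 0 2 = of_real (logdet_partial M N \<theta>) \<and>
       (\<forall>i\<le>N. \<forall>j\<le>N. s 1 i j = swept M N \<theta> i j))
     value_prog
     (\<lambda>s p w. w = [of_real (lml_value M \<theta>)] \<and> s 3 0 1 = of_nat n \<and>
       (\<forall>i\<le>N. \<forall>j\<le>N. s 1 i j = swept M N \<theta> i j))"
  unfolding value_prog_def
  by (rule triple_Emit) (simp add: ceval_re_exp N_def n_def lml_value_def)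

lemma triple_gradient_prog:
  fixes M
  defines "N \<equiv> nnodes M" and "n \<equiv> npts M"
  shows "triple M \<theta> \<rho>
     (\<lambda>s p w. w = [of_real (lml_value M \<theta>)] \<and> s 3 0 1 = of_nat n \<and>
       (\<forall>i\<le>N. \<forall>j\<le>N. s 1 i j = swept M N \<theta> i j))
     gradient_prog
     (\<lambda>s p w. w = map of_real (lml_value M \<theta> # map (lml_grad M \<theta>) [0..<nhyper M]))"
proof -
  let ?A = "\<lambda>s. s (3::nat) (0::nat) (1::nat) = of_nat n \<and> (\<forall>i\<le>N. \<forall>j\<le>N. s 1 i j = swept M N \<theta> i j)"
  let ?w = "\<lambda>k. map complex_of_real (lml_value M \<theta> # map (lml_grad M \<theta>) [0..<k])"
  let ?I = "\<lambda>k s p w. w = ?w k \<and> ?A s"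
  have body: "triple M \<theta> (\<rho>(0 := k)) (?I k)
      (Seq (sum_prog (Mul SigF2 (Mul (Wgt (IVar 1)) (DDens (IVar 0) (IVar 1)))))
        (Emit (Div (re_exp (Cell 3 (INum 0) (INum 3))) (Num 2)))) (?I (Suc k))" if "k < pdim M" for k
  proof (rule triple_Seq)
    show "triple M \<theta> (\<rho>(0 := k)) (?I k) (sum_prog (Mul SigF2 (Mul (Wgt (IVar 1)) (DDens (IVar 0) (IVar 1)))))
       (\<lambda>s p w. w = ?w k \<and> s 3 0 1 = of_nat n \<and> (\<forall>i\<le>N. \<forall>j\<le>N. s 1 i j = swept M N \<theta> i j) \<and>
        s 3 0 3 = (\<Sum>l<N. of_real (sigma_f2 M \<theta>) * (of_real (wgt M l) *
     of_real (partial_deriv (\<lambda>t. dens M t (node M l)) k (theta0 M \<theta>))) * curvature M \<theta> l))"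
      unfolding N_def by (rule triple_sum_prog) simp
  qed (rule triple_Emit, use that in \<open>simp add: ceval_re_exp lml_grad_def lml_grad_theta0_def N_def\<close>)
  have 1: "triple M \<theta> \<rho> (?I 0) (For 0 (INum 0) SizeP
      (Seq (sum_prog (Mul SigF2 (Mul (Wgt (IVar 1)) (DDens (IVar 0) (IVar 1)))))
        (Emit (Div (re_exp (Cell 3 (INum 0) (INum 3))) (Num 2))))) (?I (pdim M))"
    using triple_For[of M \<rho> "INum 0" SizeP \<theta> 0 ?I] body unfolding ieval.simps by blast
  have 2: "triple M \<theta> \<rho> (?I (pdim M)) (sum_prog (Mul (Wgt (IVar 1)) (Dens (IVar 1))))
      (\<lambda>s p w. w = ?w (pdim M) \<and> s 3 0 1 = of_nat n \<and> (\<forall>i\<le>N. \<forall>j\<le>N. s 1 i j = swept M N \<theta> i j) \<and>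
        s 3 0 3 = (\<Sum>l<N. of_real (wgt M l) * of_real (dens M (theta0 M \<theta>) (node M l)) * curvature M \<theta> l))"
    unfolding N_def by (rule triple_sum_prog) simp
  have 3: "triple M \<theta> \<rho> (\<lambda>s p w. w = ?w (pdim M) \<and> s 3 0 1 = of_nat n \<and>
        (\<forall>i\<le>N. \<forall>j\<le>N. s 1 i j = swept M N \<theta> i j) \<and>
        s 3 0 3 = (\<Sum>l<N. of_real (wgt M l) * of_real (dens M (theta0 M \<theta>) (node M l)) * curvature M \<theta> l))
      (Emit (Div (re_exp (Cell 3 (INum 0) (INum 3))) (Num 2)))
      (\<lambda>s p w. w = ?w (pdim M + 1) \<and> ?A s \<and> s 3 0 3 = weighted_curvature M \<theta>)"
    by (rule triple_Emit) (simp add: ceval_re_exp lml_grad_def weighted_curvature_def N_def)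
  have 4: "triple M \<theta> \<rho> (\<lambda>s p w. w = ?w (pdim M + 1) \<and> ?A s \<and> s 3 0 3 = weighted_curvature M \<theta>)
      (Emit (Div (Div (re_exp (Sub (Sub (Cell 1 SizeS SizeS) (Cell 3 (INum 0) (INum 1)))
      (Mul SigF2 (Cell 3 (INum 0) (INum 3))))) SigN2) (Num 2)))
      (\<lambda>s p w. w = ?w (pdim M + 2))"
    by (rule triple_Emit) (simp add: ceval_re_exp lml_grad_def lml_grad_sigma_n2_def N_def n_def)
  show ?thesis
    unfolding gradient_prog_def nhyper_def
    by (rule triple_conseq[OF triple_Seq[OF 1 triple_Seq[OF 2 triple_Seq[OF 3 4]]]]) auto
qed

lemma out_run_lml_prog:
  assumes "holds_gram M m"
  shows "out (run M \<theta> lml_prog A m) = map of_real (lml_value M \<theta> # map (lml_grad M \<theta>) [0..<nhyper M])"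
proof -
  have "triple M \<theta> (\<lambda>_. 0) (\<lambda>s p w. p = 0 \<and> w = [] \<and> (\<forall>i<nnodes M. \<forall>j<nnodes M.
       s 0 i j = cdot (npts M) (column M i) (column M j))) lml_prog
     (\<lambda>s p w. w = map of_real (lml_value M \<theta> # map (lml_grad M \<theta>) [0..<nhyper M]))"
    unfolding lml_prog_def
    by (rule triple_Seq[OF triple_stream_prog triple_Seq[OF triple_init_prog triple_Seq[OF triple_sweep_prog
      triple_Seq[OF triple_value_prog triple_gradient_prog]]]])
  moreover have "m 0 i j = cdot (npts M) (column M i) (column M j)" if "i < nnodes M" "j < nnodes M" for i j
    using assms that by (simp add: holds_gram_def gram_mat_index column_def)
  ultimately show ?thesis
    unfolding triple_def run_def Let_def by (auto dest!: spec[of _ "\<lparr>store = m, touched = A, pos = 0, out = [], steps = 0\<rparr>"])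
qed

lemma holds_gram_run_gram_prog: "holds_gram M (store (run M \<theta> gram_prog A m))"
  using triple_gram_prog[of M \<theta> "\<lambda>_. 0"]
  unfolding triple_def run_def Let_def holds_gram_def
  by (auto simp: gram_mat_index dest!: spec[of _ "\<lparr>store = m, touched = A, pos = 0, out = [], steps = 0\<rparr>"])

section \<open>Operation counts and memory\<close>

lemma cost_fill:
  assumes "\<And>k. ieval M (\<rho>(1 := k)) c = ieval M \<rho> c" "\<And>k. ieval M (\<rho>(1 := k)) d = ieval M \<rho> d"
  shows "cost M (fill A a b c d e) \<rho> =
    1 + (ieval M \<rho> b - ieval M \<rho> a) * (2 + (ieval M \<rho> d - ieval M \<rho> c) * (2 + ccost e))"
  by (simp add: fill_def assms[unfolded One_nat_def])

text \<open>For n, s >= 1 each of the six monomials in the raw count is at most n s^2, so 600 would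
  already do.\<close>

lemma cost_gram_prog:
  assumes "1 \<le> npts M" "1 \<le> nnodes M"
  shows "cost M gram_prog \<rho> \<le> 1000 * (npts M * nnodes M ^ 2)"
proof -
  let ?U = "npts M * nnodes M ^ 2"
  have s: "nnodes M \<le> nnodes M ^ 2" "1 \<le> nnodes M ^ 2"
    using assms by (simp_all add: power2_eq_square)
  note mult_le_mono1[OF assms(1), of "nnodes M ^ 2"] mult_le_mono2[OF s(1), of "npts M"]
    mult_le_mono2[OF s(2), of "npts M"]
  moreover have "cost M gram_prog \<rho> \<le>
      100 * (?U + npts M * nnodes M + npts M + nnodes M ^ 2 + nnodes M + 1)"
    by (simp add: gram_prog_def cost_fill algebra_simps power2_eq_square)
  ultimately show ?thesis using s unfolding distrib_left by linarith
qed

lemma cost_stream_init_prog: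
  "cost M stream_prog \<rho> + cost M init_prog \<rho> \<le>
     100 * (npts M * nnodes M + npts M + nnodes M ^ 2 + nnodes M + 1)"
  by (simp add: stream_prog_def init_prog_def cost_fill algebra_simps power2_eq_square)

lemma cost_sweep_prog:
  "cost M sweep_prog \<rho> \<le> 100 * (nnodes M ^ 3 + nnodes M ^ 2 + nnodes M + 1)"
  by (simp add: sweep_prog_def amp_exp_def cost_fill algebra_simps power2_eq_square power3_eq_cube)

lemma cost_output_prog:
  "cost M value_prog \<rho> + cost M gradient_prog \<rho> \<le>
     100 * (nnodes M * pdim M + pdim M + nnodes M + 1)"
  by (simp add: value_prog_def gradient_prog_def sum_prog_def re_exp_def curv_exp_def algebra_simps)

text \<open>Lower order terms are absorbed by n <= n s, p <= s p and s^2 <= s^3. As |theta| = p + 2,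
  the product s |theta| also contains 2 s, which takes the linear and constant terms.\<close>

lemma cost_lml_prog:
  assumes "1 \<le> npts M" "1 \<le> nnodes M"
  shows "cost M lml_prog \<rho> \<le> 1000 * (npts M * nnodes M + nnodes M ^ 3 + nnodes M * nhyper M)"
proof -
  let ?s = "nnodes M" and ?n = "npts M" and ?p = "pdim M"
  have "?s ^ 2 \<le> ?s ^ 3" using assms(2) by (intro power_increasing) auto
  moreover have "?n \<le> ?n * ?s" "?p \<le> ?s * ?p" using assms by simp_all
  moreover have "?s * nhyper M = ?s * ?p + 2 * ?s" by (simp add: nhyper_def)
  \<comment> \<open>The products are abstracted to plain naturals, so that only linear arithmetic
    remains.\<close>
  moreover have "c + (c' + (d + (e + e'))) \<le> 1000 * (ns + s3 + sh)"
    if "c + c' \<le> 100 * (ns + n + s2 + s + 1)" "d \<le> 100 * (s3 + s2 + s + 1)"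
      "e + e' \<le> 100 * (sp + p + s + 1)" "s2 \<le> s3" "n \<le> ns" "p \<le> sp" "sh = sp + 2 * s" "1 \<le> s"
    for c c' d e e' ns n s2 s s3 sp p sh :: nat
    using that by simp
  ultimately show ?thesis
    using cost_stream_init_prog[of M \<rho>] cost_sweep_prog[of M \<rho>] cost_output_prog[of M \<rho>] assms(2)
    unfolding lml_prog_def cost.simps by blast
qed

text \<open>The box is shared with the main program: five arrays, index s for the response column,
  and the offset 3 to cover the scalar cells of array 3 even for small s.\<close>

lemma footprint_gram_prog:
  "footprint M gram_prog \<rho> \<subseteq> {..4} \<times> {..nnodes M + 3} \<times> {..nnodes M + 3}"
  by (auto simp: gram_prog_def fill_def)

lemma footprint_lml_prog:
  "footprint M lml_prog \<rho> \<subseteq> {..4} \<times> {..nnodes M + 3} \<times> {..nnodes M + 3}"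
  by (auto simp: lml_prog_def stream_prog_def init_prog_def sweep_prog_def value_prog_def
      gradient_prog_def sum_prog_def amp_exp_def re_exp_def curv_exp_def fill_def)

lemma memory_at_most_run:
  assumes "footprint M c (\<lambda>_. 0) \<subseteq> {..4} \<times> {..nnodes M + 3} \<times> {..nnodes M + 3}"
    "A \<subseteq> gram_cells M" "1 \<le> nnodes M"
  shows "memory_at_most (run M \<theta> c A m) (1000 * nnodes M ^ 2)"
proof -
  let ?B = "{..4::nat} \<times> {..nnodes M + 3} \<times> {..nnodes M + 3}"
  have "touched (run M \<theta> c A m) \<subseteq> ?B"
    using assms(1,2) by (auto simp: run_def touched_exec gram_cells_def)
  moreover have "finite ?B" by simp
  ultimately have "finite (touched (run M \<theta> c A m))" "card (touched (run M \<theta> c A m)) \<le> card ?B"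
    by (rule finite_subset, intro card_mono)
  moreover have "card ?B = 5 * (nnodes M + 4) ^ 2"
    by (simp add: card_cartesian_product power2_eq_square add.commute)
  \<comment> \<open>Since s >= 1, the box has at most 5 * 25 s^2 = 125 s^2 cells.\<close>
  moreover have "(nnodes M + 4) ^ 2 \<le> (5 * nnodes M) ^ 2"
    using assms(3) by (intro power_mono) auto
  ultimately show ?thesis by (simp add: memory_at_most_def power_mult_distrib)
qed

text \<open>Every direction has at least one quadrature point, so the zero multi-index lies in the
  grid. Absorbing constants into the bounds relies on this.\<close>

lemma nnodes_pos:
  assumes "gl_features M"
  shows "1 \<le> nnodes M"
proof -
  have "tensor_gauss_legendre (xdim M) (halfwidth M) (nnodes M) (node M) (wgt M)"
    using assms by (simp only: gl_features_def)
  then obtain r \<xi> \<omega> e where r: "\<forall>k<xdim M. 1 \<le> r k \<and> gauss_legendre (r k) (\<xi> k) (\<omega> k)"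
    and e: "bij_betw e {..<nnodes M} (PiE {..<xdim M} (\<lambda>k. {..<r k :: nat}))"
    unfolding tensor_gauss_legendre_def by (elim exE conjE) (rule that)
  have "(\<lambda>k\<in>{..<xdim M}. 0) \<in> PiE {..<xdim M} (\<lambda>k. {..<r k})"
    by (rule restrict_PiE_iff[THEN iffD2]) (use r in \<open>simp add: Suc_le_eq\<close>)
  then have "(\<lambda>k\<in>{..<xdim M}. 0) \<in> e ` {..<nnodes M}"
    by (simp only: bij_betw_imp_surj_on[OF e])
  then show ?thesis by (cases "nnodes M") auto
qed

section \<open>The log marginal likelihood\<close>

lemma kernel_mat_carrier: "kernel_mat M \<theta> \<in> carrier_mat (npts M) (npts M)"
  by (simp add: kernel_mat_def feature_mat_def weight_mat_def mat_adjoint_def)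

lemma kernel_mat_index:
  assumes "l < npts M" "m < npts M"
  shows "kernel_mat M \<theta> $$ (l, m) = (if l = m then of_real (sigma_n2 M \<theta>) else 0) +
    (\<Sum>j<nnodes M. amplitude M j \<theta> * column M j l * cnj (column M j m))"
proof -
  let ?Z = "feature_mat M" and ?w = "\<lambda>j. complex_of_real (wgt M j * dens M (theta0 M \<theta>) (node M j))"
  have Z: "?Z \<in> carrier_mat (npts M) (nnodes M)" by (simp add: feature_mat_def)
  have adj: "mat_adjoint ?Z \<in> carrier_mat (nnodes M) (npts M)" by (rule carrier_matI) (simp_all add: mat_adjoint_def feature_mat_def)
  have "?Z * weight_mat M \<theta> = Matrix.mat (npts M) (nnodes M) (\<lambda>(i, j). ?Z $$ (i, j) * ?w j)"
    unfolding weight_mat_def by (rule mat_diag_mult_right[OF Z])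
  then have "(?Z * weight_mat M \<theta> * mat_adjoint ?Z) $$ (l, m) =
      (\<Sum>j<nnodes M. (?Z $$ (l, j) * ?w j) * mat_adjoint ?Z $$ (j, m))"
    using assms adj by (simp add: scalar_prod_def lessThan_atLeast0)
  also have "\<dots> = (\<Sum>j<nnodes M. column M j l * ?w j * cnj (column M j m))"
    using assms by (intro sum.cong refl)
      (simp add: feature_mat_def column_def node_feature_def mat_adjoint_def mat_of_rows_index)
  finally have prod: "(?Z * weight_mat M \<theta> * mat_adjoint ?Z) $$ (l, m) =
      (\<Sum>j<nnodes M. column M j l * ?w j * cnj (column M j m))" .
  have dims: "dim_row (?Z * weight_mat M \<theta> * mat_adjoint ?Z) = npts M"
    "dim_col (?Z * weight_mat M \<theta> * mat_adjoint ?Z) = npts M"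
    using Z adj by auto
  have "kernel_mat M \<theta> $$ (l, m) = of_real (sigma_f2 M \<theta>) *
      (\<Sum>j<nnodes M. column M j l * ?w j * cnj (column M j m)) +
      of_real (sigma_n2 M \<theta>) * (if l = m then 1 else 0)"
    unfolding kernel_mat_def prod[symmetric] using assms dims by (simp del: index_mult_mat)
  then show ?thesis by (simp add: sum_distrib_left amplitude_def mult_ac)
qed

lemma hyperparams_rank_one_updates:
  assumes "gl_features M" "\<theta> \<in> hyperparams M"
  shows "rank_one_updates (nnodes M) (sigma_n2 M \<theta>)
    (\<lambda>k. sigma_f2 M \<theta> * (wgt M k * dens M (theta0 M \<theta>) (node M k)))"
proof
  show "0 < sigma_n2 M \<theta>" using assms(2) by (simp add: hyperparams_def)
  fix k assume "k < nnodes M"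
  then have "0 < wgt M k * dens M (theta0 M \<theta>) (node M k)" "0 < sigma_f2 M \<theta>"
    using assms by (simp_all add: gl_features_def hyperparams_def)
  then show "0 < sigma_f2 M \<theta> * (wgt M k * dens M (theta0 M \<theta>) (node M k))" by simp
qed

text \<open>Identifies the kernel matrix with \<open>updmat\<close> at the final stage. The claims
  on the pivots are what differentiating the recursion and its logarithms requires.\<close>

lemma log_marginal_eq_lml_value:
  assumes "gl_features M" "\<theta> \<in> hyperparams M"
  shows "log_marginal M \<theta> = lml_value M \<theta>"
    and "k < nnodes M \<Longrightarrow> Im (1 + amplitude M k \<theta> * swept M k \<theta> k k) = 0"
    and "k < nnodes M \<Longrightarrow> 0 < Re (1 + amplitude M k \<theta> * swept M k \<theta> k k)"
proof -
  let ?n = "npts M" and ?s = "nnodes M"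
  interpret rank_one_updates ?n ?s "sigma_n2 M \<theta>"
    "\<lambda>k. sigma_f2 M \<theta> * (wgt M k * dens M (theta0 M \<theta>) (node M k))" "column M"
    by (rule hyperparams_rank_one_updates[OF assms])
  have amp: "amplitude M k \<theta> =
      complex_of_real (sigma_f2 M \<theta> * (wgt M k * dens M (theta0 M \<theta>) (node M k)))" for k
    by (simp add: amplitude_def)
  have sw: "swept M k \<theta> i j = cdot ?n (column M i) (sol k (column M j))" for k i j
    unfolding swept_def amp by (rule sweep_eq_cdot_sol)
  have K: "kernel_mat M \<theta> = updmat ?s"
    using kernel_mat_carrier[of M \<theta>]
    by (intro eq_matI) (auto simp: kernel_mat_index updmat_def amp)
  have y: "Matrix.vec ?n (\<lambda>l. complex_of_real (resp M l)) = Matrix.vec ?n (column M ?s)"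
    by (simp add: column_def)
  \<comment> \<open>\<open>scalar_prod\<close> does not conjugate whereas \<open>cdot\<close> does;
    the two agree because the responses are real.\<close>
  have "scalar_prod (Matrix.vec ?n (column M ?s)) (Matrix.vec ?n (sol ?s (column M ?s))) = swept M ?s \<theta> ?s ?s"
    by (simp add: sw scalar_prod_def cdot_def lessThan_atLeast0 column_def)
  moreover have "ln (Re (Determinant.det (updmat ?s))) = logdet_partial M ?s \<theta>"
    unfolding ln_det_updmat logdet_partial_def sw amp by simp
  ultimately show "log_marginal M \<theta> = lml_value M \<theta>"
    by (simp only: log_marginal_def Let_def K y mat_inverse_updmat lml_value_def)
  show "0 < Re (1 + amplitude M k \<theta> * swept M k \<theta> k k)" if "k < ?s"
    unfolding amp sw using Re_factor_pos[OF that] .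
  obtain r where "swept M k \<theta> k k = of_real r" if "k < ?s"
    using sol_self_real[of k "column M k"] unfolding sw by (metis less_imp_le)
  then show "Im (1 + amplitude M k \<theta> * swept M k \<theta> k k) = 0" if "k < ?s"
    unfolding amp using that by simp
qed

section \<open>Differentiability in the hyperparameters\<close>

lemma eventually_Rn_at_Rn: "\<forall>\<^sub>F v in at_Rn m x. v \<in> Rn m"
  unfolding eventually_at_Rn by (intro exI[of _ 1]) simp

text \<open>Dropping coordinates does not increase the Euclidean distance.\<close>

lemma filterlim_restrict_at_Rn:
  assumes "m \<le> m'"
  shows "filterlim (\<lambda>v. restrict v {..<m}) (at_Rn m (restrict x {..<m})) (at_Rn m' x)"
  unfolding filterlim_iff
proof (intro allI impI)
  fix P assume "eventually P (at_Rn m (restrict x {..<m}))"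
  then obtain \<delta> where \<delta>: "\<delta> > 0" and P: "\<And>v. v \<in> Rn m \<Longrightarrow>
      L2_set (\<lambda>i. v i - restrict x {..<m} i) {..<m} < \<delta> \<Longrightarrow> P v"
    unfolding eventually_at_Rn by blast
  have "P (restrict v {..<m})" if "L2_set (\<lambda>i. v i - x i) {..<m'} < \<delta>" for v
  proof (rule P)
    have "L2_set (\<lambda>i. restrict v {..<m} i - restrict x {..<m} i) {..<m} = L2_set (\<lambda>i. v i - x i) {..<m}"
      by (intro L2_set_cong) auto
    also have "\<dots> \<le> L2_set (\<lambda>i. v i - x i) {..<m'}"
      using assms unfolding L2_set_def by (intro real_sqrt_le_mono sum_mono2) auto
    finally show "L2_set (\<lambda>i. restrict v {..<m} i - restrict x {..<m} i) {..<m} < \<delta>"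
      using that by simp
  qed simp
  then show "\<forall>\<^sub>F v in at_Rn m' x. P (restrict v {..<m})"
    unfolding eventually_at_Rn by (intro exI[of _ \<delta>]) (simp add: \<delta>)
qed

text \<open>Lifts differentiability of the density in theta_0 to the full hyperparameter vector; the
  two variances get slope 0.\<close>

lemma has_slopes_restrict:
  assumes "has_slopes m f g (restrict x {..<m})" "m \<le> m'"
  shows "has_slopes m' (\<lambda>v. f (restrict v {..<m})) (\<lambda>i. if i < m then g i else 0) x"
proof -
  let ?r = "\<lambda>v. restrict v {..<m}"
  obtain \<phi> where \<phi>: "\<forall>i<m. (\<phi> i \<longlongrightarrow> g i) (at_Rn m (?r x))"
    and e: "\<forall>\<^sub>F v in at_Rn m (?r x). f v = f (?r x) + (\<Sum>i<m. \<phi> i v * of_real (v i - ?r x i))"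
    by (rule has_slopesE[OF assms(1)])
  note lim = filterlim_restrict_at_Rn[OF assms(2), of x]
  show ?thesis
  proof (rule has_slopesI[of _ "\<lambda>i v. if i < m then \<phi> i (?r v) else 0"])
    show "((\<lambda>v. if i < m then \<phi> i (?r v) else 0) \<longlongrightarrow> (if i < m then g i else 0)) (at_Rn m' x)" for i
    proof (cases "i < m")
      case True
      show ?thesis using filterlim_compose[OF \<phi>[rule_format, OF True] lim] True by simp
    qed simp
    have "\<forall>\<^sub>F v in at_Rn m' x. f (?r v) = f (?r x) + (\<Sum>i<m. \<phi> i (?r v) * of_real (?r v i - ?r x i))"
      using filterlim_iff[THEN iffD1, OF lim, rule_format, OF e] .
    then show "\<forall>\<^sub>F v in at_Rn m' x. f (?r v) = f (?r x) +
        (\<Sum>i<m'. (if i < m then \<phi> i (?r v) else 0) * of_real (v i - x i))"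
    proof eventually_elim
      case (elim v)
      have "(\<Sum>i<m. \<phi> i (?r v) * of_real (?r v i - ?r x i)) =
          (\<Sum>i<m'. (if i < m then \<phi> i (?r v) else 0) * of_real (v i - x i))"
        by (rule sum.mono_neutral_cong_left) (use assms(2) in auto)
      with elim show ?case by simp
    qed
  qed
qed

text \<open>Around \<open>x\<close> the set contains an open box. With finitely many coordinates,
  each eventually in its side, points of \<open>Rn m\<close> eventually enter the box.\<close>

lemma eventually_openin_at_Rn:
  assumes "openin (product_topology (\<lambda>_. euclideanreal) {..<m}) S" "x \<in> S"
  shows "\<forall>\<^sub>F v in at_Rn m x. v \<in> S"
proof -
  obtain U where o: "\<forall>i\<in>{..<m}. openin euclideanreal (U i)"
    and U: "x \<in> PiE {..<m} U" "PiE {..<m} U \<subseteq> S"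
    using assms(1)[unfolded openin_product_topology_alt, rule_format, OF assms(2)]
    by (elim exE conjE) (rule that)
  have "\<forall>\<^sub>F v in at_Rn m x. v i \<in> U i" if "i < m" for i
  proof (rule topological_tendstoD[OF tendsto_coordinate_at_Rn[OF that]])
    show "open (U i)" using o that by simp
    show "x i \<in> U i" using U(1) that by (simp add: PiE_iff)
  qed
  then have "\<forall>\<^sub>F v in at_Rn m x. \<forall>i\<in>{..<m}. v i \<in> U i"
    by (intro eventually_ball_finite) auto
  with eventually_Rn_at_Rn[of m x] show ?thesis
    by eventually_elim (rule subsetD[OF U(2)], simp add: PiE_iff)
qed

text \<open>The formula for the likelihood is established on \<open>hyperparams M\<close> only;
  transferring its gradient needs agreement near the point, not merely at it.\<close>

lemma eventually_hyperparams:
  assumes "gl_features M" "\<theta> \<in> hyperparams M"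
  shows "\<forall>\<^sub>F v in at_Rn (nhyper M) \<theta>. v \<in> hyperparams M"
proof -
  have "openin (product_topology (\<lambda>_. euclideanreal) {..<pdim M}) (pdom M)" "theta0 M \<theta> \<in> pdom M"
    using assms by (simp_all add: gl_features_def hyperparams_def)
  then have "\<forall>\<^sub>F t in at_Rn (pdim M) (theta0 M \<theta>). t \<in> pdom M"
    by (rule eventually_openin_at_Rn)
  then have 1: "\<forall>\<^sub>F v in at_Rn (nhyper M) \<theta>. theta0 M v \<in> pdom M"
    unfolding theta0_def
    by (rule filterlim_iff[THEN iffD1, OF filterlim_restrict_at_Rn, rule_format, rotated])
      (simp add: nhyper_def)
  have "((\<lambda>v. v (pdim M)) \<longlongrightarrow> \<theta> (pdim M)) (at_Rn (nhyper M) \<theta>)"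
    "((\<lambda>v. v (pdim M + 1)) \<longlongrightarrow> \<theta> (pdim M + 1)) (at_Rn (nhyper M) \<theta>)"
    by (rule tendsto_coordinate_at_Rn, simp add: nhyper_def)+
  moreover have "0 < \<theta> (pdim M)" "0 < \<theta> (pdim M + 1)"
    using assms(2) by (simp_all add: hyperparams_def sigma_f2_def sigma_n2_def)
  ultimately have "\<forall>\<^sub>F v in at_Rn (nhyper M) \<theta>. 0 < sigma_f2 M v"
    "\<forall>\<^sub>F v in at_Rn (nhyper M) \<theta>. 0 < sigma_n2 M v"
    unfolding sigma_f2_def sigma_n2_def by (auto dest: order_tendstoD(1))
  with 1 eventually_Rn_at_Rn[of "nhyper M" \<theta>] show ?thesis
    by eventually_elim (simp add: hyperparams_def)
qed

lemma node_in_Rn: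
  assumes "gl_features M" "j < nnodes M"
  shows "node M j \<in> Rn (xdim M)"
proof -
  have "tensor_gauss_legendre (xdim M) (halfwidth M) (nnodes M) (node M) (wgt M)"
    using assms by (simp only: gl_features_def)
  then show ?thesis
    unfolding tensor_gauss_legendre_def by (elim exE conjE) (simp add: assms(2))
qed

lemma has_slopes_lml_value:
  assumes "gl_features M" "\<theta> \<in> hyperparams M"
  shows "has_slopes (nhyper M) (lml_value M) (lml_grad M \<theta>) \<theta>"
proof -
  let ?s = "nnodes M" and ?n = "npts M" and ?m = "nhyper M" and ?P = "pdim M"
  \<comment> \<open>\<open>dt\<close>, \<open>df\<close>, \<open>dd\<close> and \<open>da\<close>
    are the gradients of sigma_n^2, sigma_f^2, the density at a node and the amplitude.\<close>
  define dt where "dt p = (if p = ?P + 1 then 1 else 0 :: complex)" for p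
  define df where "df p = (if p = ?P then 1 else 0 :: complex)" for p
  define dd where "dd l p = complex_of_real
    (if p < ?P then partial_deriv (\<lambda>t. dens M t (node M l)) p (theta0 M \<theta>) else 0)" for l p
  define da where "da l p = df p * (of_real (wgt M l) * of_real (dens M (theta0 M \<theta>) (node M l))) +
    of_real (sigma_f2 M \<theta>) * (of_real (wgt M l) * dd l p)" for l p
  have dens: "has_slopes ?m (\<lambda>v. complex_of_real (dens M (theta0 M v) (node M l))) (dd l) \<theta>"
    if l: "l < ?s" for l
  proof -
    let ?f = "\<lambda>t. dens M t (node M l)"
    have t: "theta0 M \<theta> \<in> Rn ?P" "theta0 M \<theta> \<in> pdom M"
      using assms(2) by (simp_all add: theta0_def hyperparams_def)
    then obtain g where g: "has_gradient ?P ?f g (theta0 M \<theta>)"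
      using assms(1) node_in_Rn[OF assms(1) l] unfolding gl_features_def by blast
    have "has_slopes ?P ?f g (restrict \<theta> {..<?P})"
      using has_gradient_imp_has_slopes[OF g t(1)] unfolding theta0_def .
    then have "has_slopes ?m (\<lambda>v. ?f (restrict v {..<?P})) (\<lambda>i. if i < ?P then g i else 0) \<theta>"
      by (rule has_slopes_restrict) (simp add: nhyper_def)
    then have "has_slopes ?m (\<lambda>v. complex_of_real (?f (theta0 M v)))
        (\<lambda>i. complex_of_real (if i < ?P then g i else 0)) \<theta>"
      unfolding theta0_def by (rule has_slopes_of_real)
    then show ?thesis
      by (rule has_slopes_eq) (simp add: dd_def has_gradient_partial_deriv[OF g t(1)])
  qed
  have sf: "has_slopes ?m (\<lambda>v. complex_of_real (sigma_f2 M v)) df \<theta>"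
    unfolding sigma_f2_def df_def by (rule has_slopes_coordinate) (simp add: nhyper_def)
  have sn: "has_slopes ?m (\<lambda>v. complex_of_real (sigma_n2 M v)) dt \<theta>"
    unfolding sigma_n2_def dt_def by (rule has_slopes_coordinate) (simp add: nhyper_def)
  have amp: "has_slopes ?m (amplitude M l) (da l) \<theta>" if "l < ?s" for l
    unfolding amplitude_def[abs_def] da_def
    by (intro has_slopes_mult[OF sf] has_slopes_cmult dens that)
  have \<tau>: "0 < sigma_n2 M \<theta>" using assms(2) by (simp add: hyperparams_def)
  define Q where "Q = swept M ?s \<theta>"
  note sgn = log_marginal_eq_lml_value(2,3)[OF assms]
  have nz: "1 + amplitude M k \<theta> * swept M k \<theta> k k \<noteq> 0" if "k < ?s" for k
    using sgn(2)[OF that] by force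
  define D where "D p = - (\<Sum>l<?s. da l p * Q ?s l * Q l ?s) -
       dt p / of_real (sigma_n2 M \<theta>) * (Q ?s ?s - (\<Sum>l<?s. amplitude M l \<theta> * Q ?s l * Q l ?s))" for p
  define E where "E p = (\<Sum>l<?s. da l p * Q l l) +
      dt p / of_real (sigma_n2 M \<theta>) * (of_nat ?n - (\<Sum>l<?s. amplitude M l \<theta> * Q l l))" for p
  have 1: "has_slopes ?m (\<lambda>v. swept M ?s v ?s ?s) D \<theta>"
    unfolding D_def Q_def swept_def
    by (rule has_slopes_sweep[OF sn _ amp]) (use \<tau> nz in \<open>auto simp: swept_def\<close>)
  have 2: "has_slopes ?m (logdet_partial M ?s) (\<lambda>p. Re (E p)) \<theta>"
    unfolding E_def Q_def swept_def logdet_partial_def[abs_def]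
    by (rule has_slopes_logdet[OF sn _ _ amp]) (use \<tau> sgn in \<open>auto simp: swept_def\<close>)
  have "has_slopes ?m (lml_value M) (\<lambda>p. - 1 / 2 * Re (D p) - 1 / 2 * Re (E p) - 0) \<theta>"
    unfolding lml_value_def[abs_def]
    by (intro has_slopes_diff has_slopes_cmult has_slopes_Re 1 2 has_slopes_const)
  then show ?thesis
  proof (rule has_slopes_eq)
    fix p assume p: "p < ?m"
    have H: "curvature M \<theta> l = Q ?s l * Q l ?s - Q l l" for l
      by (simp add: curvature_def Q_def)
    \<comment> \<open>This is 2 dL: the quadratic form and the log determinant enter with the same
      sign, and their sums combine into H_l.\<close>
    have DE: "- D p - E p = (\<Sum>l<?s. da l p * curvature M \<theta> l) + dt p / of_real (sigma_n2 M \<theta>) *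
        (Q ?s ?s - of_nat ?n - (\<Sum>l<?s. amplitude M l \<theta> * curvature M \<theta> l))"
      unfolding D_def E_def H by (simp add: algebra_simps sum_subtractf)
    have amps: "(\<Sum>l<?s. amplitude M l \<theta> * curvature M \<theta> l) = of_real (sigma_f2 M \<theta>) * weighted_curvature M \<theta>"
      by (simp add: amplitude_def weighted_curvature_def sum_distrib_left mult.assoc)
    consider "p < ?P" | "p = ?P" | "p = ?P + 1" using p by (force simp: nhyper_def)
    then have "Re (- D p - E p) / 2 = lml_grad M \<theta> p"
    proof cases
      case 1
      then show ?thesis
        unfolding DE by (simp add: lml_grad_def lml_grad_theta0_def dt_def da_def df_def dd_def mult.assoc)
    next
      case 2
      then show ?thesis
        unfolding DE by (simp add: lml_grad_def weighted_curvature_def dt_def da_def df_def dd_def)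
    next
      case 3
      then have "- D p - E p = (Q ?s ?s - of_nat ?n - of_real (sigma_f2 M \<theta>) * weighted_curvature M \<theta>) /
          of_real (sigma_n2 M \<theta>)"
        unfolding DE amps by (simp add: dt_def da_def df_def dd_def)
      then show ?thesis
        using 3 by (simp add: lml_grad_def lml_grad_sigma_n2_def Q_def Re_divide_of_real
            del: minus_complex.sel uminus_complex.sel)
    qed
    then show "lml_grad M \<theta> p = - 1 / 2 * Re (D p) - 1 / 2 * Re (E p) - 0"
      by (simp add: field_simps)
  qed
qed

lemma has_gradient_log_marginal:
  assumes "gl_features M" "\<theta> \<in> hyperparams M"
  shows "has_gradient (nhyper M) (log_marginal M) (lml_grad M \<theta>) \<theta>"
proof (rule has_slopes_imp_has_gradient, rule has_slopes_cong[OF has_slopes_lml_value[OF assms]])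
  show "\<forall>\<^sub>F v in at_Rn (nhyper M) \<theta>. log_marginal M v = lml_value M v"
    using eventually_hyperparams[OF assms]
    by eventually_elim (rule log_marginal_eq_lml_value(1)[OF assms(1)])
qed (simp_all add: log_marginal_eq_lml_value(1)[OF assms])

theorem proposition6:
  shows "\<exists>(pre :: com) (main :: com) (C :: nat). \<forall>M :: gl_model. gl_features M \<longrightarrow>
    (\<forall>\<theta> m. let \<sigma> = run M \<theta> pre {} m in
       holds_gram M (store \<sigma>) \<and>
       steps \<sigma> \<le> C * (npts M * nnodes M ^ 2) \<and>
       memory_at_most \<sigma> (C * nnodes M ^ 2)) \<and>
    (\<forall>\<theta>\<in>hyperparams M. \<forall>m. holds_gram M m \<longrightarrow>
       (let \<sigma> = run M \<theta> main (gram_cells M) m in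
         (\<exists>g. has_gradient (nhyper M) (log_marginal M) g \<theta> \<and>
              out \<sigma> = map complex_of_real (log_marginal M \<theta> # map g [0..<nhyper M])) \<and>
         steps \<sigma> \<le> C * (npts M * nnodes M + nnodes M ^ 3 + nnodes M * nhyper M) \<and>
         memory_at_most \<sigma> (C * nnodes M ^ 2)))"
  \<comment> \<open>One generous constant serves all bounds; the counts themselves give 600 for the
    preprocessing, 300 for the main program and 125 for the memory.\<close>
  proof (rule exI[of _ gram_prog], rule exI[of _ lml_prog], rule exI[of _ 1000], intro allI impI)
  fix M assume M: "gl_features M"
  then have n: "1 \<le> npts M" by (simp add: gl_features_def)
  note s = nnodes_pos[OF M]
  show "(\<forall>\<theta> m. let \<sigma> = run M \<theta> gram_prog {} m in
       holds_gram M (store \<sigma>) \<and>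
       steps \<sigma> \<le> 1000 * (npts M * nnodes M ^ 2) \<and>
       memory_at_most \<sigma> (1000 * nnodes M ^ 2)) \<and>
    (\<forall>\<theta>\<in>hyperparams M. \<forall>m. holds_gram M m \<longrightarrow>
       (let \<sigma> = run M \<theta> lml_prog (gram_cells M) m in
         (\<exists>g. has_gradient (nhyper M) (log_marginal M) g \<theta> \<and>
              out \<sigma> = map complex_of_real (log_marginal M \<theta> # map g [0..<nhyper M])) \<and>
         steps \<sigma> \<le> 1000 * (npts M * nnodes M + nnodes M ^ 3 + nnodes M * nhyper M) \<and>
         memory_at_most \<sigma> (1000 * nnodes M ^ 2)))"
    unfolding Let_def
  proof (intro conjI allI ballI impI)
    fix \<theta> m
    show "holds_gram M (store (run M \<theta> gram_prog {} m))"
      by (rule holds_gram_run_gram_prog)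
    show "steps (run M \<theta> gram_prog {} m) \<le> 1000 * (npts M * nnodes M ^ 2)"
      using cost_gram_prog[OF n s] by (simp add: run_def steps_exec)
    show "memory_at_most (run M \<theta> gram_prog {} m) (1000 * nnodes M ^ 2)"
      by (rule memory_at_most_run[OF footprint_gram_prog _ s]) simp
  next
    fix \<theta> m assume \<theta>: "\<theta> \<in> hyperparams M" and m: "holds_gram M m"
    show "\<exists>g. has_gradient (nhyper M) (log_marginal M) g \<theta> \<and>
        out (run M \<theta> lml_prog (gram_cells M) m) =
          map complex_of_real (log_marginal M \<theta> # map g [0..<nhyper M])"
      using has_gradient_log_marginal[OF M \<theta>] out_run_lml_prog[OF m]
      unfolding log_marginal_eq_lml_value(1)[OF M \<theta>] by (intro exI[of _ "lml_grad M \<theta>"]) simp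
    show "steps (run M \<theta> lml_prog (gram_cells M) m) \<le>
        1000 * (npts M * nnodes M + nnodes M ^ 3 + nnodes M * nhyper M)"
      using cost_lml_prog[OF n s] by (simp add: run_def steps_exec)
    show "memory_at_most (run M \<theta> lml_prog (gram_cells M) m) (1000 * nnodes M ^ 2)"
      by (rule memory_at_most_run[OF footprint_lml_prog _ s]) simp
  qed
qed

end
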